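(* Let $V$, $H$, $\widetilde{H}$ be complex Hilbert spaces, let $j \colon V \to H$ be a continuous linear map and $\tilde{j} \colon V \to \widetilde{H}$ a compact linear map. Let $\mathfrak{a}$ and, for all $n \in \mathbb{N}$, $\mathfrak{a}_n$ be continuous symmetric sesquilinear forms $V \times V \to \mathbb{C}$. Suppose that the sequence $(\mathfrak{a}_n)_{n \in \mathbb{N}}$ is uniformly $\tilde{j}$-elliptic and converges weakly to $\mathfrak{a}$. Moreover, suppose that $\lim_{n \to \infty} \dim W(\mathfrak{a}_n) = \dim W(\mathfrak{a})$. Let $A_n$ be the graph associated with $(\mathfrak{a}_n,j)$ and $A$ the graph associated with $(\mathfrak{a},j)$. Then $$\lim_{n \to \infty} (A_n + i s I)^{-1} = (A + i s I)^{-1}$$ strongly for all $s \in \mathbb{R} \setminus \{0\}$. Moreover, if in addition the map $j$ is compact, then the convergence is uniform in $\mathcal{L}(H)$ (i.e. in operator norm).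
   Context: Sesquilinear forms are linear in the first and antilinear in the second variable, and $\mathfrak{a}(u) := \mathfrak{a}(u,u)$. $\mathcal{L}(H)$ denotes the bounded linear operators on $H$. The sequence $(\mathfrak{a}_n)$ is uniformly $\tilde{j}$-elliptic if there exist $\mu,\omega > 0$ such that $\mathfrak{a}_n(u) + \omega \|\tilde{j}(u)\|_{\widetilde{H}}^2 \geq \mu \|u\|_V^2$ for all $n \in \mathbb{N}$ and $u \in V$. The sequence $(\mathfrak{a}_n)$ converges weakly to $\mathfrak{a}$ if $\lim_{n\to\infty} \mathfrak{a}_n(u_n,v) = \mathfrak{a}(u,v)$ for all $v \in V$ and all $u,u_1,u_2,\ldots \in V$ with $u_n \to u$ weakly in $V$. For a form $\mathfrak{b}$ on $V$, $W(\mathfrak{b}) := \{u \in \ker j : \mathfrak{b}(u,v) = 0 \text{ for all } v \in V\}$. If $V$, $H$, $\widetilde{H}$ are complex Hilbert spaces, $j \colon V \to H$ is continuous linear, $\tilde{j} \colon V \to \widetilde{H}$ is compact linear, and $\mathfrak{a}$, $\mathfrak{a}_n$ ($n \in \mathbb{N}$) are continuous symmetric sesquilinear forms on $V$ such that $(\mathfrak{a}_n)$ is uniformly $\tilde{j}$-elliptic and converges weakly to $\mathfrak{a}$, then the spaces $W(\mathfrak{a})$ and $W(\mathfrak{a}_n)$ are finite dimensional. A graph in $H$ is a linear subspace of $H \times H$. The graph associated with a form $\mathfrak{b}$ on $V$ and $j$ is $$\{(x,y) \in H \times H : \text{there exists } u \in V \text{ such that } j(u) = x \text{ and } \mathfrak{b}(u,v)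 = (y,j(v))_H \text{ for all } v \in V\}.$$ If $V$, $H$, $\widetilde{H}$ are complex Hilbert spaces, $j \colon V \to H$ is continuous linear, $\tilde{j} \colon V \to \widetilde{H}$ is compact linear, and $\mathfrak{a}$, $\mathfrak{a}_n$ ($n \in \mathbb{N}$) are continuous symmetric sesquilinear forms on $V$ such that $(\mathfrak{a}_n)$ is uniformly $\tilde{j}$-elliptic and converges weakly to $\mathfrak{a}$, then $A$ and all $A_n$ are self-adjoint graphs, and for a self-adjoint graph $A$ and $s \in \mathbb{R}\setminus\{0\}$ the graph $A + isI = \{(x,y+isx) : (x,y) \in A\}$ is invertible: for every $y \in H$ there is a unique $x =: (A+isI)^{-1}y$ with $(x,y) \in A + isI$, and $(A+isI)^{-1}$ is a bounded operator on $H$. *)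

theory Defs
  imports "HOL-Analysis.Analysis"
begin

(* A complex inner product space is a real inner product space with a compatible complex
   structure: the real inner product is the real part of the complex one, so the norm is
   given by norm x ^ 2 = cinner x x (lemma cinner_self) and the topology is the norm topology.
   The complex inner product is linear in the first and antilinear in the second variable. *)

class complex_inner = real_inner +
  fixes scaleC :: "complex \<Rightarrow> 'a \<Rightarrow> 'a" (infixr \<open>*\<^sub>C\<close> 75)
    and cinner :: "'a \<Rightarrow> 'a \<Rightarrow> complex"
  assumes scaleC_of_real: "complex_of_real r *\<^sub>C x = r *\<^sub>R x"
    and scaleC_add_right: "c *\<^sub>C (x + y) = c *\<^sub>C x + c *\<^sub>C y"
    and scaleC_add_left: "(c + d) *\<^sub>C x = c *\<^sub>C x + d *\<^sub>C x"
    and scaleC_scaleC: "c *\<^sub>C d *\<^sub>C x = (c * d) *\<^sub>C x"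
    and cinner_commute: "cinner x y = cnj (cinner y x)"
    and cinner_add_left: "cinner (x + y) z = cinner x z + cinner y z"
    and cinner_scaleC_left: "cinner (c *\<^sub>C x) y = c * cinner x y"
    and Re_cinner: "Re (cinner x y) = inner x y"

class chilbert_space = complex_inner + complete_space

instantiation complex :: chilbert_space
begin

definition scaleC_complex :: "complex \<Rightarrow> complex \<Rightarrow> complex"
  where "scaleC_complex c x = c * x"

definition cinner_complex :: "complex \<Rightarrow> complex \<Rightarrow> complex"
  where "cinner_complex x y = x * cnj y"

instance
  by standard
    (simp_all add: scaleC_complex_def cinner_complex_def scaleR_conv_of_real algebra_simps
      inner_complex_def)

end

lemma cinner_self: "cinner x x = complex_of_real ((norm x)\<^sup>2)"
proof (rule complex_eqI)
  show "Re (cinner x x) = Re (complex_of_real ((norm x)\<^sup>2))"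
    by (simp add: Re_cinner power2_norm_eq_inner)
  have "Im (cinner x x) = - Im (cinner x x)"
    by (subst cinner_commute) simp
  then show "Im (cinner x x) = Im (complex_of_real ((norm x)\<^sup>2))"
    by simp
qed

lemma scaleC_one: "1 *\<^sub>C x = (x :: 'a :: complex_inner)"
  using scaleC_of_real[of 1 x] by simp

global_interpretation complex_vector: vector_space "scaleC :: complex \<Rightarrow> 'a \<Rightarrow> 'a :: complex_inner"
  by unfold_locales (simp_all add: scaleC_add_right scaleC_add_left scaleC_scaleC scaleC_one)

(* The dimension of a space without finite basis is 0 here. It is only used for the spaces
   form_W below, which are finite dimensional for uniformly elliptic, weakly convergent
   sequences and their limits. *)

abbreviation cdim :: "'a :: complex_inner set \<Rightarrow> nat"
  where "cdim \<equiv> complex_vector.dim"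

abbreviation clinear :: "('a :: complex_inner \<Rightarrow> 'b :: complex_inner) \<Rightarrow> bool"
  where "clinear \<equiv> Vector_Spaces.linear (*\<^sub>C) (*\<^sub>C)"

definition bounded_clinear :: "('a :: complex_inner \<Rightarrow> 'b :: complex_inner) \<Rightarrow> bool"
  where "bounded_clinear f \<longleftrightarrow> clinear f \<and> bounded_linear f"

definition compact_map :: "('a :: complex_inner \<Rightarrow> 'b :: complex_inner) \<Rightarrow> bool"
  where "compact_map f \<longleftrightarrow> (\<forall>S. bounded S \<longrightarrow> compact (closure (f ` S)))"

definition weakly_tendsto :: "(nat \<Rightarrow> 'a :: complex_inner) \<Rightarrow> 'a \<Rightarrow> bool"
  where "weakly_tendsto u u0 \<longleftrightarrow>
    (\<forall>\<phi> :: 'a \<Rightarrow> complex. bounded_clinear \<phi> \<longrightarrow> (\<lambda>n. \<phi> (u n)) \<longlonglongrightarrow> \<phi> u0)"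

type_synonym 'v form = "'v \<Rightarrow> 'v \<Rightarrow> complex"

definition sesquilinear :: "'v :: complex_inner form \<Rightarrow> bool"
  where "sesquilinear b \<longleftrightarrow>
    (\<forall>u u' v. b (u + u') v = b u v + b u' v) \<and>
    (\<forall>c u v. b (c *\<^sub>C u) v = c * b u v) \<and>
    (\<forall>u v v'. b u (v + v') = b u v + b u v') \<and>
    (\<forall>c u v. b u (c *\<^sub>C v) = cnj c * b u v)"

definition symmetric_form :: "'v :: complex_inner form \<Rightarrow> bool"
  where "symmetric_form b \<longleftrightarrow> (\<forall>u v. b u v = cnj (b v u))"

definition continuous_form :: "'v :: complex_inner form \<Rightarrow> bool"
  where "continuous_form b \<longleftrightarrow> continuous_on UNIV (\<lambda>(u, v). b u v)"

(* Only used for symmetric forms, where b u u is real. *)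

definition uniformly_elliptic ::
    "(nat \<Rightarrow> 'v :: complex_inner form) \<Rightarrow> ('v \<Rightarrow> 'k :: complex_inner) \<Rightarrow> bool"
  where "uniformly_elliptic b jt \<longleftrightarrow>
    (\<exists>\<mu> > 0. \<exists>\<omega> > 0. \<forall>n u. Re (b n u u) + \<omega> * (norm (jt u))\<^sup>2 \<ge> \<mu> * (norm u)\<^sup>2)"

definition forms_converge_weakly ::
    "(nat \<Rightarrow> 'v :: complex_inner form) \<Rightarrow> 'v form \<Rightarrow> bool"
  where "forms_converge_weakly b b0 \<longleftrightarrow>
    (\<forall>v u0 u. weakly_tendsto u u0 \<longrightarrow> (\<lambda>n. b n (u n) v) \<longlonglongrightarrow> b0 u0 v)"

definition form_W :: "('v :: complex_inner \<Rightarrow> 'h :: complex_inner) \<Rightarrow> 'v form \<Rightarrow> 'v set"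
  where "form_W j b = {u. j u = 0 \<and> (\<forall>v. b u v = 0)}"

definition form_graph ::
    "'v form \<Rightarrow> ('v :: complex_inner \<Rightarrow> 'h :: complex_inner) \<Rightarrow> ('h \<times> 'h) set"
  where "form_graph b j = {(x, y). \<exists>u. j u = x \<and> (\<forall>v. b u v = cinner y (j v))}"

definition graph_shift :: "('h :: complex_inner \<times> 'h) set \<Rightarrow> complex \<Rightarrow> ('h \<times> 'h) set"
  where "graph_shift A z = {(x, y + z *\<^sub>C x) | x y. (x, y) \<in> A}"

(* Junk unless x is unique; this is the first conjunct of graph_invertible. *)

definition graph_inverse :: "('h :: complex_inner \<times> 'h) set \<Rightarrow> 'h \<Rightarrow> 'h"
  where "graph_inverse A y = (THE x. (x, y) \<in> A)"

definition graph_invertible :: "('h :: complex_inner \<times> 'h) set \<Rightarrow> bool"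
  where "graph_invertible A \<longleftrightarrow>
    (\<forall>y. \<exists>!x. (x, y) \<in> A) \<and> bounded_clinear (graph_inverse A)"

(* Convergence in L(H): membership of all operators is part of the notion; without it, onorm
   could be a supremum over an unbounded set. *)

definition converges_strongly ::
    "(nat \<Rightarrow> 'h \<Rightarrow> 'h :: complex_inner) \<Rightarrow> ('h \<Rightarrow> 'h) \<Rightarrow> bool"
  where "converges_strongly T T0 \<longleftrightarrow>
    (\<forall>n. bounded_clinear (T n)) \<and> bounded_clinear T0 \<and> (\<forall>x. (\<lambda>n. T n x) \<longlonglongrightarrow> T0 x)"

definition converges_uniformly ::
    "(nat \<Rightarrow> 'h \<Rightarrow> 'h :: complex_inner) \<Rightarrow> ('h \<Rightarrow> 'h) \<Rightarrow> bool"
  where "converges_uniformly T T0 \<longleftrightarrow>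
    (\<forall>n. bounded_clinear (T n)) \<and> bounded_clinear T0 \<and>
    (\<lambda>n. onorm (\<lambda>x. T n x - T0 x)) \<longlonglongrightarrow> 0"

end

theory Submission
  imports Defs
begin

text \<open>
The equation \<open>(A_n + i s) x = y\<close> means \<open>x = j u\<close> with \<open>a_n(u, v) + i s (j u, j v) = (y, j v)\<close> for all \<open>v\<close>. Let
\<open>B_n\<close> be the operator on \<open>V\<close> of the form on the left, so that the equation reads \<open>B_n u = j* y\<close>. Symmetry of the form
shows that both \<open>B_n\<close> and its adjoint have the kernel \<open>W(a_n)\<close>, which \<open>j\<close> annihilates, and that
\<open>norm (j u) \<le> norm y / \<bar>s\<bar>\<close>.

Uniform ellipticity says that \<open>D_n = B_n + \<omega> jt* jt\<close> is uniformly coercive, with a compact perturbation independent of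
\<open>n\<close>. Weak convergence of the forms is the same as strong convergence \<open>B_n v \<longrightarrow> B v\<close> for every \<open>v\<close>
(\<open>forms_converge_strongly\<close>), and therefore the inverses of \<open>D_n\<close> converge strongly. This gives asymptotic compactness
(\<open>coercive_mod_compact.convergent_subsequence\<close>): if \<open>u_n\<close> is bounded and \<open>B_n u_n\<close> converges to \<open>f\<close>, then a subsequence
of \<open>u_n\<close> converges in norm to a solution of \<open>B u = f\<close>. For constant sequences it shows that each \<open>B_n\<close>, and also \<open>B\<close>,
has closed range, whence the resolvents exist.

It remains to bound the solutions \<open>u_n\<close> orthogonal to \<open>W(a_n)\<close>. If they were unbounded, their normalisations would
accumulate at a unit vector of \<open>W(a)\<close>. Here the dimensions enter (\<open>no_escape_if_dimensions_converge\<close>): adding such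
normalised solutions to \<open>W(a_n)\<close> would give spaces of dimension \<open>dim W(a) + 1\<close> whose unit vectors accumulate in \<open>W(a)\<close>,
which is impossible. So the \<open>u_n\<close> are bounded, and every subsequence has a further one converging to a solution of the
limit equation (\<open>coercive_mod_compact.difference_of_solutions_tendsto_0\<close>). The argument allows the data \<open>y\<close> to vary with
\<open>n\<close> as long as the sequence \<open>j* y_n\<close> is relatively compact. For constant data this is strong convergence; if \<open>j\<close> is
compact, then so is \<open>j*\<close>, every bounded sequence of data is allowed, and the convergence is uniform.
\<close>

section \<open>Riesz representation in real Hilbert spaces\<close>

lemma parallelogram_midpoint:
  fixes a b :: "'a::real_inner"
  shows "(norm (b - a))\<^sup>2 + 4 * (norm ((1/2) *\<^sub>R (a + b)))\<^sup>2 = 2 * (norm a)\<^sup>2 + 2 * (norm b)\<^sup>2"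
  by (simp add: power_divide)
    (simp add: power2_norm_eq_inner inner_diff_left inner_diff_right inner_add_left inner_add_right
      inner_commute[of b a])

text \<open>By the parallelogram law, two points that both nearly realise the distance from \<open>x\<close> must be close to
each other, because otherwise their midpoint would lie nearer to \<open>x\<close> than that distance allows.\<close>

lemma minimizing_sequence_Cauchy:
  fixes x :: "'a::real_inner"
  assumes d: "\<And>m n. d \<le> dist x ((1/2) *\<^sub>R (p m + p n))" and "d \<ge> 0"
    and p: "\<And>n. (dist x (p n))\<^sup>2 \<le> d\<^sup>2 + e n" and e: "e \<longlonglongrightarrow> 0"
  shows "Cauchy p"
proof (rule metric_CauchyI)
  fix \<epsilon> :: real
  assume "\<epsilon> > 0"
  then have "eventually (\<lambda>n. e n < \<epsilon>\<^sup>2 / 4) sequentially"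
    using order_tendstoD(2)[OF e, of "\<epsilon>\<^sup>2 / 4"] by simp
  then obtain N where N: "\<And>n. n \<ge> N \<Longrightarrow> e n < \<epsilon>\<^sup>2 / 4"
    by (auto simp: eventually_sequentially)
  have "dist (p m) (p n) < \<epsilon>" if "m \<ge> N" "n \<ge> N" for m n
  proof -
    have "(norm ((x - p n) - (x - p m)))\<^sup>2 + 4 * (norm ((1/2) *\<^sub>R ((x - p m) + (x - p n))))\<^sup>2
        = 2 * (norm (x - p m))\<^sup>2 + 2 * (norm (x - p n))\<^sup>2"
      by (rule parallelogram_midpoint)
    moreover have "(1/2) *\<^sub>R ((x - p m) + (x - p n)) = x - (1/2) *\<^sub>R (p m + p n)"
      by (simp add: scaleR_diff_right scaleR_add_right flip: scaleR_add_left)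
    ultimately have "(dist (p m) (p n))\<^sup>2 + 4 * (dist x ((1/2) *\<^sub>R (p m + p n)))\<^sup>2
        = 2 * (dist x (p m))\<^sup>2 + 2 * (dist x (p n))\<^sup>2"
      by (simp add: dist_norm)
    moreover have "(dist x ((1/2) *\<^sub>R (p m + p n)))\<^sup>2 \<ge> d\<^sup>2"
      using d[of m n] \<open>d \<ge> 0\<close> by (intro power_mono)
    ultimately have "(dist (p m) (p n))\<^sup>2 \<le> 2 * e m + 2 * e n"
      using p[of m] p[of n] by linarith
    also have "\<dots> < \<epsilon>\<^sup>2"
      using N[OF that(1)] N[OF that(2)] by linarith
    finally show ?thesis
      using \<open>\<epsilon> > 0\<close> by (simp add: power_less_imp_less_base)
  qed
  then show "\<exists>M. \<forall>m\<ge>M. \<forall>n\<ge>M. dist (p m) (p n) < \<epsilon>"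
    by blast
qed

text \<open>The point of \<open>S\<close> closest to \<open>x\<close> is the limit of a minimizing sequence. It satisfies a variational inequality
in the directions \<open>v\<close> and \<open>-v\<close>, hence an equality.\<close>

lemma orthogonal_projection_exists:
  fixes S :: "'a::real_inner set"
  assumes S: "subspace S" and "complete S"
  obtains p where "p \<in> S" "\<And>v. v \<in> S \<Longrightarrow> inner (x - p) v = 0"
proof -
  have ne: "S \<noteq> {}"
    using subspace_0[OF S] by blast
  define d where "d = infdist x S"
  have d0: "d \<ge> 0"
    by (simp add: d_def infdist_nonneg)
  have "\<exists>q\<in>S. (dist x q)\<^sup>2 \<le> d\<^sup>2 + inverse (real (Suc n))" for n
  proof -
    have "d < sqrt (d\<^sup>2 + inverse (real (Suc n)))"
      using d0 by (intro real_less_rsqrt) simp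
    then have "(INF q\<in>S. dist x q) < sqrt (d\<^sup>2 + inverse (real (Suc n)))"
      using ne by (simp add: d_def infdist_notempty)
    moreover have "bdd_below (dist x ` S)"
      by (auto intro: bdd_belowI[of _ 0])
    ultimately obtain q where q: "q \<in> S" "dist x q < sqrt (d\<^sup>2 + inverse (real (Suc n)))"
      using ne by (auto simp: cINF_less_iff)
    have "(dist x q)\<^sup>2 \<le> (sqrt (d\<^sup>2 + inverse (real (Suc n))))\<^sup>2"
      using q(2) by (intro power_mono) auto
    with q(1) show ?thesis
      by (intro bexI[of _ q]) (auto simp del: of_nat_Suc)
  qed
  then obtain q where qS: "\<And>n. q n \<in> S"
    and q: "\<And>n. (dist x (q n))\<^sup>2 \<le> d\<^sup>2 + inverse (real (Suc n))"
    by metis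
  have "d \<le> dist x ((1/2) *\<^sub>R (q m + q n))" for m n
    unfolding d_def by (intro infdist_le subspace_scale[OF S] subspace_add[OF S] qS)
  then have "Cauchy q"
    using q d0 LIMSEQ_inverse_real_of_nat by (intro minimizing_sequence_Cauchy[where e = "\<lambda>n. inverse (real (Suc n))"])
  then obtain p where pS: "p \<in> S" and lim: "q \<longlonglongrightarrow> p"
    using \<open>complete S\<close> qS unfolding complete_def by blast
  have "(\<lambda>n. (dist x (q n))\<^sup>2) \<longlonglongrightarrow> (dist x p)\<^sup>2"
    by (intro tendsto_intros lim)
  moreover have "(\<lambda>n. d\<^sup>2 + inverse (real (Suc n))) \<longlonglongrightarrow> d\<^sup>2 + 0"
    by (intro tendsto_add tendsto_const LIMSEQ_inverse_real_of_nat)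
  ultimately have "(dist x p)\<^sup>2 \<le> d\<^sup>2 + 0"
    using q by (intro LIMSEQ_le) auto
  then have "dist x p \<le> d"
    using power2_le_imp_le[of "dist x p" d] d0 by simp
  then have min: "\<forall>z\<in>S. dist x p \<le> dist x z"
    using infdist_le[of _ S x] by (auto simp: d_def intro: order_trans)
  have "inner (x - p) v = 0" if "v \<in> S" for v
  proof -
    have "inner (x - p) ((p + v) - p) \<le> 0" "inner (x - p) ((p - v) - p) \<le> 0"
      using any_closest_point_dot[OF subspace_imp_convex[OF S] complete_imp_closed[OF \<open>complete S\<close>] pS _ min]
        subspace_add[OF S pS that] subspace_diff[OF S pS that] by blast+
    then show ?thesis
      by (simp add: inner_minus_right)
  qed
  with pS show thesis
    by (rule that)
qed

text \<open>A vector \<open>h\<close> orthogonal to the hyperplane \<open>ker \<phi>\<close> represents \<open>\<phi>\<close> after rescaling, since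
\<open>v - (\<phi> v / \<phi> h) h\<close> lies in that hyperplane.\<close>

lemma Riesz_representation:
  fixes \<phi> :: "'a::{real_inner, complete_space} \<Rightarrow> real"
  assumes "bounded_linear \<phi>"
  obtains g where "\<And>v. \<phi> v = inner g v"
proof -
  interpret bounded_linear \<phi> by fact
  have S: "subspace {v. \<phi> v = 0}"
    by (auto simp: subspace_def zero add scaleR)
  have "closed {v. \<phi> v = 0}"
    by (intro closed_Collect_eq continuous_on continuous_intros linear_continuous_on assms)
  then have cS: "complete {v. \<phi> v = 0}"
    by (simp add: complete_eq_closed)
  show thesis
  proof (cases "\<forall>v. \<phi> v = 0")
    case True
    then show thesis
      by (intro that[of 0]) simp
  next
    case False
    then obtain x where x: "\<phi> x \<noteq> 0"
      by blast
    obtain p where p: "\<phi> p = 0" and orth: "\<And>v. \<phi> v = 0 \<Longrightarrow> inner (x - p) v = 0"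
      by (rule orthogonal_projection_exists[OF S cS, of x]) auto
    define h where "h = x - p"
    have \<phi>h: "\<phi> h = \<phi> x"
      by (simp add: h_def diff p)
    then have "h \<noteq> 0"
      using x zero by auto
    have "\<phi> v = inner ((\<phi> h / inner h h) *\<^sub>R h) v" for v
    proof -
      have "inner h (v - (\<phi> v / \<phi> h) *\<^sub>R h) = 0"
        unfolding h_def by (intro orth) (simp add: diff scaleR p x)
      then show ?thesis
        using \<open>h \<noteq> 0\<close> x \<phi>h by (simp add: inner_diff_right field_simps)
    qed
    then show thesis
      by (rule that)
  qed
qed

text \<open>Riesz representation applied in the second argument. Both the operators of the forms and all adjoints
arise in this way.\<close>

lemma bounded_bilinear_representation:
  fixes c :: "'a::real_normed_vector \<Rightarrow> 'v::{real_inner, complete_space} \<Rightarrow> real"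
  assumes "bounded_bilinear c"
  obtains T where "bounded_linear T" "\<And>u v. inner (T u) v = c u v"
proof -
  interpret bounded_bilinear c by fact
  have "\<exists>g. \<forall>v. c u v = inner g v" for u
    using Riesz_representation[OF bounded_linear_right] by metis
  then obtain T where T: "\<And>u v. c u v = inner (T u) v"
    by metis
  obtain K where "K \<ge> 0" and K: "\<And>u v. norm (c u v) \<le> norm u * norm v * K"
    using nonneg_bounded by blast
  have "bounded_linear T"
  proof (rule bounded_linear_intro[where K = K])
    show "T (x + y) = T x + T y" for x y
      by (rule vector_eq_rdot[THEN iffD1]) (simp add: inner_add_left flip: T add: add_left)
    show "T (r *\<^sub>R x) = r *\<^sub>R T x" for r x
      by (rule vector_eq_rdot[THEN iffD1]) (simp flip: T add: scaleR_left)
    show "norm (T x) \<le> norm x * K" for x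
    proof (cases "T x = 0")
      case True
      with \<open>K \<ge> 0\<close> show ?thesis
        by simp
    next
      case False
      have "norm (T x) * norm (T x) \<le> (norm x * K) * norm (T x)"
        using K[of x "T x"] by (simp add: T power2_norm_eq_inner[symmetric] power2_eq_square mult_ac)
      then show ?thesis
        using False by simp
    qed
  qed
  then show thesis
    by (intro that) (simp_all add: T)
qed

text \<open>Coercivity bounds \<open>D\<close> from below, so its range is complete; a vector orthogonal to the range is
orthogonal to its own image, and coercivity forces it to vanish.\<close>

lemma Lax_Milgram:
  fixes D :: "'v::{real_inner, complete_space} \<Rightarrow> 'v"
  assumes D: "bounded_linear D" and "\<mu> > 0" and coercive: "\<And>u. \<mu> * (norm u)\<^sup>2 \<le> inner (D u) u"
  shows "surj D"
proof -
  interpret bounded_linear D by fact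
  have lower: "\<mu> * norm u \<le> norm (D u)" for u
  proof (cases "u = 0")
    case False
    have "(\<mu> * norm u) * norm u \<le> norm (D u) * norm u"
      using coercive[of u] norm_cauchy_schwarz[of "D u" u] by (simp add: power2_eq_square mult_ac)
    then show ?thesis
      using False by simp
  qed (simp add: zero)
  have S: "subspace (range D)"
    using subspace_UNIV by (rule linear_subspace_image[OF linear_axioms])
  have "complete (range D)"
    using lower complete_UNIV by (intro complete_isometric_image[OF \<open>\<mu> > 0\<close> subspace_UNIV D]) auto
  have "x \<in> range D" for x
  proof -
    obtain p where p: "p \<in> range D" "\<And>v. v \<in> range D \<Longrightarrow> inner (x - p) v = 0"
      by (rule orthogonal_projection_exists[OF S \<open>complete (range D)\<close>, of x]) auto
    have "\<mu> * (norm (x - p))\<^sup>2 \<le> 0"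
      using coercive[of "x - p"] p(2)[of "D (x - p)"] by (simp add: inner_commute)
    then have "x = p"
      using \<open>\<mu> > 0\<close> by (simp add: mult_le_0_iff)
    with p show ?thesis
      by simp
  qed
  then show ?thesis
    by blast
qed

section \<open>Relatively compact sequences\<close>

text \<open>Sequential form of relative compactness of the range, stated for the subsequences as well, so that it can
be applied after earlier extractions.\<close>

definition relatively_compact_seq :: "(nat \<Rightarrow> 'a::topological_space) \<Rightarrow> bool"
  where "relatively_compact_seq x \<longleftrightarrow>
    (\<forall>r :: nat \<Rightarrow> nat. strict_mono r \<longrightarrow> (\<exists>s :: nat \<Rightarrow> nat. strict_mono s \<and> convergent (\<lambda>n. x (r (s n)))))"

lemma LIMSEQ_if_subsequences:
  fixes x :: "nat \<Rightarrow> 'a::metric_space"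
  assumes "\<And>r :: nat \<Rightarrow> nat. strict_mono r \<Longrightarrow> \<exists>s :: nat \<Rightarrow> nat. strict_mono s \<and> (\<lambda>n. x (r (s n))) \<longlonglongrightarrow> l"
  shows "x \<longlonglongrightarrow> l"
proof (rule ccontr)
  assume "\<not> x \<longlonglongrightarrow> l"
  then obtain e where "e > 0" and inf: "\<And>N. \<exists>n\<ge>N. dist (x n) l \<ge> e"
    unfolding lim_sequentially by (meson not_le)
  then have "infinite {n. dist (x n) l \<ge> e}"
    by (auto simp: infinite_nat_iff_unbounded_le)
  then obtain r :: "nat \<Rightarrow> nat" where r: "strict_mono r" "\<And>n. dist (x (r n)) l \<ge> e"
    using infinite_enumerate by blast
  obtain s where s: "(\<lambda>n. x (r (s n))) \<longlonglongrightarrow> l"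
    using assms[OF r(1)] by blast
  obtain n where "dist (x (r (s n))) l < e"
    using metric_LIMSEQ_D[OF s \<open>e > 0\<close>] by blast
  with r(2)[of "s n"] show False
    by simp
qed

lemma relatively_compact_seq_const: "relatively_compact_seq (\<lambda>n. c)"
  unfolding relatively_compact_seq_def by (auto intro: strict_mono_id convergent_const)

lemma relatively_compact_seqD:
  assumes "relatively_compact_seq x" and "strict_mono r"
  obtains s :: "nat \<Rightarrow> nat" and l where "strict_mono s" "(\<lambda>n. x (r (s n))) \<longlonglongrightarrow> l"
  using assms unfolding relatively_compact_seq_def convergent_def by blast

lemma unbounded_seq_subseq:
  fixes x :: "nat \<Rightarrow> 'a::real_normed_vector"
  assumes "\<not> Bseq x"
  obtains r :: "nat \<Rightarrow> nat" where "strict_mono r" "\<And>n. norm (x (r n)) \<ge> real (Suc n)"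
proof -
  have large: "\<exists>y>m. norm (x y) \<ge> real n" for m n
  proof (rule ccontr)
    assume "\<not> ?thesis"
    then have "\<forall>k. norm (x (k + Suc m)) \<le> real n"
      by (metis add_Suc_right less_add_Suc2 linear)
    then have "Bseq (\<lambda>k. x (k + Suc m))"
      by (auto simp: Bseq_def intro!: exI[of _ "real n + 1"] intro: order_trans)
    with assms show False
      by (simp add: Bseq_offset)
  qed
  have "\<exists>r :: nat \<Rightarrow> nat. \<forall>n. norm (x (r n)) \<ge> real (Suc n) \<and> r n < r (Suc n)"
  proof (rule dependent_nat_choice)
    show "\<exists>y. norm (x y) \<ge> real (Suc 0)"
      using large[of 0 "Suc 0"] by blast
    show "\<exists>y. norm (x y) \<ge> real (Suc (Suc n)) \<and> m < y" for m n
      using large[of m "Suc (Suc n)"] by blast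
  qed
  then show thesis
    using that by (auto simp: strict_mono_Suc_iff)
qed

section \<open>Coercive operators up to a compact perturbation\<close>

text \<open>The operators \<open>B n\<close> stand for the forms \<open>a_n(u, v) + i s (j u, j v)\<close>, and \<open>K\<close> for
\<open>\<omega> jt* jt\<close>, so that the last assumption is uniform ellipticity. The compact part \<open>K\<close> is the same for all
\<open>n\<close>; this is why no compactness has to be tracked along the sequence. Real linearity suffices, since
the forms are represented through their real parts.\<close>

locale coercive_mod_compact =
  fixes B :: "nat \<Rightarrow> 'v::{real_inner, complete_space} \<Rightarrow> 'v"
    and B0 :: "'v \<Rightarrow> 'v" and K :: "'v \<Rightarrow> 'v" and \<mu> :: real
  assumes lin: "\<And>n. bounded_linear (B n)" and lin0: "bounded_linear B0"
    and linK: "bounded_linear K"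
    and K_compact: "\<And>x. Bseq x \<Longrightarrow> relatively_compact_seq (\<lambda>n. K (x n))"
    and strong: "\<And>v. (\<lambda>n. B n v) \<longlonglongrightarrow> B0 v"
    and \<mu>: "\<mu> > 0"
    and coercive: "\<And>n u. \<mu> * (norm u)\<^sup>2 \<le> inner (B n u + K u) u"
begin

lemma subsequence:
  assumes r: "strict_mono (r :: nat \<Rightarrow> nat)"
  shows "coercive_mod_compact (\<lambda>n. B (r n)) B0 K \<mu>"
proof (rule coercive_mod_compact.intro)
  show "(\<lambda>n. B (r n) v) \<longlonglongrightarrow> B0 v" for v
    using LIMSEQ_subseq_LIMSEQ[OF strong r] by (simp add: comp_def)
qed (simp_all add: lin lin0 linK K_compact \<mu> coercive)

lemma limit_coercive: "\<mu> * (norm u)\<^sup>2 \<le> inner (B0 u + K u) u"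
proof (rule LIMSEQ_le_const)
  show "(\<lambda>n. inner (B n u + K u) u) \<longlonglongrightarrow> inner (B0 u + K u) u"
    by (intro tendsto_intros strong)
qed (use coercive in blast)

lemma constant_sequence: "coercive_mod_compact (\<lambda>n. B m) (B m) K \<mu>"
  by (rule coercive_mod_compact.intro) (simp_all add: lin lin0 linK K_compact \<mu> coercive)

lemma constant_limit_sequence: "coercive_mod_compact (\<lambda>n. B0) B0 K \<mu>"
  by (rule coercive_mod_compact.intro) (simp_all add: lin lin0 linK K_compact \<mu> limit_coercive)

lemma lower_bound: "\<mu> * norm u \<le> norm (B n u + K u)"
proof (cases "u = 0")
  case False
  have "(\<mu> * norm u) * norm u \<le> norm (B n u + K u) * norm u"
    using coercive[of u n] norm_cauchy_schwarz[of "B n u + K u" u]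
    by (simp add: power2_eq_square mult_ac)
  then show ?thesis
    using False by simp
qed simp

text \<open>The asymptotic compactness behind all limit arguments. Write \<open>D n = B n + K\<close>. Along a subsequence
\<open>K (u n)\<close> converges, hence so does \<open>D n (u n)\<close>, say to \<open>g\<close>. The operators \<open>D n\<close> are uniformly bounded
below and converge strongly to the invertible operator \<open>B0 + K\<close>, so \<open>u n\<close> converges in norm to the
solution \<open>u0\<close> of \<open>B0 u0 + K u0 = g\<close>.\<close>

lemma convergent_subsequence:
  assumes "Bseq u" and f: "(\<lambda>n. B n (u n)) \<longlonglongrightarrow> f"
  obtains s :: "nat \<Rightarrow> nat" and u0 where "strict_mono s" "(\<lambda>n. u (s n)) \<longlonglongrightarrow> u0" "B0 u0 = f"
proof -
  obtain s :: "nat \<Rightarrow> nat" and h where s: "strict_mono s" and h: "(\<lambda>n. K (u (s n))) \<longlonglongrightarrow> h"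
    using relatively_compact_seqD[OF K_compact[OF \<open>Bseq u\<close>] strict_mono_id] by (auto simp: id_def)
  have "surj (\<lambda>u. B0 u + K u)"
    by (rule Lax_Milgram[OF bounded_linear_add[OF lin0 linK] \<mu> limit_coercive])
  then obtain u0 where u0: "f + h = B0 u0 + K u0"
    by (auto dest: surjD[of _ "f + h"])
  have fs: "(\<lambda>n. B (s n) (u (s n))) \<longlonglongrightarrow> f"
    using LIMSEQ_subseq_LIMSEQ[OF f s] by (simp add: comp_def)
  have Bs: "(\<lambda>n. B (s n) u0) \<longlonglongrightarrow> B0 u0"
    using LIMSEQ_subseq_LIMSEQ[OF strong s] by (simp add: comp_def)
  have "(\<lambda>n. (B (s n) (u (s n)) + K (u (s n))) - (B (s n) u0 + K u0)) \<longlonglongrightarrow> (f + h) - (B0 u0 + K u0)"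
    by (intro tendsto_intros fs h Bs)
  then have "(\<lambda>n. norm ((B (s n) (u (s n)) + K (u (s n))) - (B (s n) u0 + K u0)) / \<mu>) \<longlonglongrightarrow> norm (0::'v) / \<mu>"
    unfolding u0 diff_self using \<mu> by (intro tendsto_intros) auto
  then have lim0: "(\<lambda>n. norm ((B (s n) (u (s n)) + K (u (s n))) - (B (s n) u0 + K u0)) / \<mu>) \<longlonglongrightarrow> 0"
    by simp
  have "norm (u (s n) - u0) \<le> norm ((B (s n) (u (s n)) + K (u (s n))) - (B (s n) u0 + K u0)) / \<mu>" for n
  proof -
    have "B (s n) (u (s n) - u0) + K (u (s n) - u0)
        = (B (s n) (u (s n)) + K (u (s n))) - (B (s n) u0 + K u0)"
      by (simp only: linear_diff[OF bounded_linear.linear[OF lin]]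
          linear_diff[OF bounded_linear.linear[OF linK]] add_diff_add)
    with lower_bound[of "u (s n) - u0" "s n"] show ?thesis
      using \<mu> by (simp only: pos_le_divide_eq mult.commute)
  qed
  then have "(\<lambda>n. u (s n) - u0) \<longlonglongrightarrow> 0"
    by (intro Lim_null_comparison[OF _ lim0]) auto
  then have u: "(\<lambda>n. u (s n)) \<longlonglongrightarrow> u0"
    by (simp add: LIM_zero_iff)
  have "(\<lambda>n. K (u (s n))) \<longlonglongrightarrow> K u0"
    by (rule bounded_linear.tendsto[OF linK u])
  with h have "h = K u0"
    by (rule LIMSEQ_unique)
  with u0 have "B0 u0 = f"
    by simp
  with s u show thesis
    by (rule that)
qed

text \<open>If the limit kernel had directions that the kernels of the \<open>B n\<close> do not approximate, then solutions orthogonal to the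
latter could grow without bound along such directions. This condition excludes that.\<close>

definition no_kernel_escape :: bool
  where "no_kernel_escape \<longleftrightarrow> (\<forall>(r :: nat \<Rightarrow> nat) v u. strict_mono r \<longrightarrow>
    (\<forall>n w. B (r n) w = 0 \<longrightarrow> inner (v n) w = 0) \<longrightarrow> v \<longlonglongrightarrow> u \<longrightarrow> B0 u = 0 \<longrightarrow> u = 0)"

lemma no_kernel_escapeD:
  assumes no_kernel_escape and "strict_mono (r :: nat \<Rightarrow> nat)"
    and "\<And>n w. B (r n) w = 0 \<Longrightarrow> inner (v n) w = 0" and "v \<longlonglongrightarrow> u" and "B0 u = 0"
  shows "u = 0"
  using assms unfolding no_kernel_escape_def by metis

text \<open>If \<open>u\<close> were unbounded, normalised members of it would have images tending to 0, and by
\<open>convergent_subsequence\<close> they would accumulate at a unit vector of the limit kernel, while being orthogonal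
to the kernels of the \<open>B n\<close>.\<close>

lemma Bseq_if_orthogonal_to_kernels:
  assumes gap: "no_kernel_escape"
    and orth: "\<And>n w. B n w = 0 \<Longrightarrow> inner (u n) w = 0" and "Bseq (\<lambda>n. B n (u n))"
  shows "Bseq u"
proof (rule ccontr)
  assume "\<not> Bseq u"
  then obtain r :: "nat \<Rightarrow> nat" where r: "strict_mono r" and large: "\<And>n. norm (u (r n)) \<ge> real (Suc n)"
    using unbounded_seq_subseq by blast
  have pos: "norm (u (r n)) > 0" for n
    using large[of n] by linarith
  define v where "v n = u (r n) /\<^sub>R norm (u (r n))" for n
  have norm_v: "norm (v n) = 1" for n
    using pos[of n] by (simp add: v_def)
  obtain C where C: "C > 0" "\<And>n. norm (B n (u n)) \<le> C"
    using \<open>Bseq (\<lambda>n. B n (u n))\<close> by (auto simp: Bseq_def)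
  have "norm (B (r n) (v n)) \<le> C * inverse (real (Suc n))" for n
  proof -
    have "norm (B (r n) (v n)) = norm (B (r n) (u (r n))) * inverse (norm (u (r n)))"
      by (simp add: v_def linear_scale[OF bounded_linear.linear[OF lin]])
    also have "\<dots> \<le> C * inverse (real (Suc n))"
      using C pos[of n] large[of n] by (intro mult_mono le_imp_inverse_le) auto
    finally show ?thesis .
  qed
  moreover have "(\<lambda>n. C * inverse (real (Suc n))) \<longlonglongrightarrow> 0"
    using tendsto_mult_right_zero[OF LIMSEQ_inverse_real_of_nat] .
  ultimately have Bv: "(\<lambda>n. B (r n) (v n)) \<longlonglongrightarrow> 0"
    by (rule Lim_null_comparison[OF always_eventually[OF allI]])
  interpret sub: coercive_mod_compact "\<lambda>n. B (r n)" B0 K \<mu>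
    by (rule subsequence[OF r])
  have "Bseq v"
    using norm_v by (intro BseqI'[of _ 1]) simp
  then obtain s :: "nat \<Rightarrow> nat" and v0 where s: "strict_mono s" and v0: "(\<lambda>n. v (s n)) \<longlonglongrightarrow> v0" "B0 v0 = 0"
    using sub.convergent_subsequence[OF _ Bv] by blast
  have rs: "strict_mono (\<lambda>n. r (s n))"
    using r s by (simp add: strict_mono_def)
  have "v0 = 0"
    by (rule no_kernel_escapeD[OF gap rs _ v0]) (simp add: v_def orth)
  then have "(\<lambda>n. norm (v (s n))) \<longlonglongrightarrow> 0"
    using tendsto_norm[OF v0(1)] by simp
  then show False
    by (simp add: norm_v LIMSEQ_const_iff)
qed

lemma kernel_subspace: "subspace {u. B n u = 0}"
  by (rule linear_subspace_kernel[OF bounded_linear.linear[OF lin]])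

lemma orthogonal_to_kernel:
  obtains w where "B n w = 0" "\<And>w'. B n w' = 0 \<Longrightarrow> inner (u - w) w' = 0"
proof -
  have "closed {u. B n u = 0}"
    using closed_Collect_eq[OF linear_continuous_on[OF lin] continuous_on_const] .
  then have "complete {u. B n u = 0}"
    by (simp add: complete_eq_closed)
  then obtain w where "w \<in> {u. B n u = 0}" "\<And>w'. w' \<in> {u. B n u = 0} \<Longrightarrow> inner (u - w) w' = 0"
    by (rule orthogonal_projection_exists[OF kernel_subspace, of n u]) blast
  then show thesis
    by (intro that[of w]) simp_all
qed

text \<open>For a constant sequence the limit vector is orthogonal to itself. This makes the results for sequences
available for each single operator.\<close>

lemma constant_no_kernel_escape:
  "coercive_mod_compact.no_kernel_escape (\<lambda>n. B m) (B m)"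
proof -
  interpret const: coercive_mod_compact "\<lambda>n. B m" "B m" K \<mu>
    by (rule constant_sequence)
  show ?thesis
    unfolding const.no_kernel_escape_def
  proof (intro allI impI)
    fix r :: "nat \<Rightarrow> nat" and v u
    assume "\<forall>n w. B m w = 0 \<longrightarrow> inner (v n) w = 0" "v \<longlonglongrightarrow> u" "B m u = 0"
    then have "inner (v n) u = 0" for n
      by blast
    moreover have "(\<lambda>n. inner (v n) u) \<longlonglongrightarrow> inner u u"
      by (intro tendsto_intros \<open>v \<longlonglongrightarrow> u\<close>)
    ultimately show "u = 0"
      by (simp add: LIMSEQ_const_iff)
  qed
qed

text \<open>Fredholm argument for one operator: on the orthogonal complement \<open>?N\<close> of its kernel, \<open>B n\<close> is bounded
below, so the image of \<open>?N\<close>, which is the whole range, is complete.\<close>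

lemma complete_range: "complete (range (B n))"
proof -
  let ?N = "{u. \<forall>w. B n w = 0 \<longrightarrow> inner u w = 0}"
  interpret const: coercive_mod_compact "\<lambda>_. B n" "B n" K \<mu>
    by (rule constant_sequence)
  interpret Bn: bounded_linear "B n"
    by (rule lin)
  have sub: "subspace ?N"
    by (auto simp: subspace_def inner_add_left)
  have "closed ?N"
    by (intro closed_Collect_all closed_Collect_imp open_Collect_const closed_Collect_eq continuous_intros)
  then have cN: "complete ?N"
    by (simp add: complete_eq_closed)
  have "\<exists>e>0. \<forall>u\<in>?N. norm (B n u) \<ge> e * norm u"
  proof (rule ccontr)
    assume "\<not> ?thesis"
    moreover have "inverse (real (Suc k)) > 0" for k
      by simp
    ultimately have "\<exists>u\<in>?N. norm (B n u) < inverse (real (Suc k)) * norm u" for k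
      by (meson not_le)
    then have "\<forall>k. \<exists>u. u \<in> ?N \<and> norm (B n u) < inverse (real (Suc k)) * norm u"
      by blast
    then obtain u where u: "\<And>k. u k \<in> ?N" "\<And>k. norm (B n (u k)) < inverse (real (Suc k)) * norm (u k)"
      by (drule_tac choice) blast
    have pos: "norm (u k) > 0" for k
      using u(2)[of k] Bn.zero by (cases "u k = 0") auto
    \<comment> \<open>Scaled so that the images stay bounded although \<open>norm (v k) = k + 1\<close>.\<close>
    define v where "v k = (real (Suc k) / norm (u k)) *\<^sub>R u k" for k
    have "norm (B n (v k)) \<le> 1" for k
      using u(2)[of k] pos[of k] by (simp add: v_def Bn.scaleR field_simps del: of_nat_Suc)
    then have BBv: "Bseq (\<lambda>k. B n (v k))"
      by (rule BseqI')
    have orth: "inner (v k) w = 0" if "B n w = 0" for k w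
      using u(1)[of k] that by (simp add: v_def)
    have Bv: "Bseq v"
      by (rule const.Bseq_if_orthogonal_to_kernels[OF constant_no_kernel_escape orth BBv])
    have "norm (v k) = real (Suc k)" for k
      using pos[of k] by (simp add: v_def del: of_nat_Suc)
    moreover obtain C where "\<And>k. norm (v k) \<le> C"
      using Bv by (rule BseqE) blast
    ultimately have C: "real (Suc k) \<le> C" for k
      by simp
    obtain k where "C < real k"
      using reals_Archimedean2 by blast
    with C[of k] show False
      by simp
  qed
  then have "complete (B n ` ?N)"
    using complete_isometric_image[OF _ sub lin _ cN] by blast
  also have "B n ` ?N = range (B n)"
  proof (intro equalityI subsetI)
    fix y
    assume "y \<in> range (B n)"
    then obtain u where y: "y = B n u"
      by blast
    obtain w where "B n w = 0" "\<And>w'. B n w' = 0 \<Longrightarrow> inner (u - w) w' = 0"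
      using orthogonal_to_kernel by blast
    then show "y \<in> B n ` ?N"
      using y by (intro image_eqI[of _ _ "u - w"]) (auto simp: Bn.diff)
  qed auto
  finally show ?thesis .
qed

text \<open>As the range is complete, solvability follows once \<open>f\<close> is orthogonal to everything that is orthogonal to the
range. The solution can then be made orthogonal to the kernel.\<close>

lemma solvable:
  assumes "\<And>g. (\<And>u. inner (B n u) g = 0) \<Longrightarrow> inner f g = 0"
  obtains u where "B n u = f" "\<And>w. B n w = 0 \<Longrightarrow> inner u w = 0"
proof -
  interpret Bn: bounded_linear "B n"
    by (rule lin)
  have "subspace (range (B n))"
    using subspace_UNIV by (rule linear_subspace_image[OF Bn.linear_axioms])
  then obtain p where p: "p \<in> range (B n)" "\<And>v. v \<in> range (B n) \<Longrightarrow> inner (f - p) v = 0"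
    by (rule orthogonal_projection_exists[OF _ complete_range]) blast
  have "inner f (f - p) = 0"
    using p(2) by (intro assms) (simp add: inner_commute)
  moreover have "inner p (f - p) = 0"
    using p by (simp add: inner_commute)
  ultimately have "inner (f - p) (f - p) = 0"
    by (simp add: inner_diff_left)
  then have "f = p"
    by simp
  with p obtain u where u: "B n u = f"
    by blast
  obtain w where "B n w = 0" "\<And>w'. B n w' = 0 \<Longrightarrow> inner (u - w) w' = 0"
    using orthogonal_to_kernel by blast
  then show thesis
    using u by (intro that[of "u - w"]) (auto simp: Bn.diff)
qed

text \<open>The solutions \<open>u n\<close> and \<open>v n\<close> for the same right-hand sides stay bounded, so along a common subsequence they
converge to two solutions of the same limit equation. These differ by an element of the limit kernel, which
\<open>j\<close> annihilates. Constant right-hand sides yield strong convergence of the resolvents, right-hand sides from a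
relatively compact sequence yield convergence in norm.\<close>

lemma difference_of_solutions_tendsto_0:
  fixes j :: "'v \<Rightarrow> 'h::real_normed_vector"
  assumes j: "bounded_linear j" and ker: "\<And>w. B0 w = 0 \<Longrightarrow> j w = 0"
    and gap: "no_kernel_escape"
    and f: "relatively_compact_seq f"
    and u: "\<And>n. B n (u n) = f n" "\<And>n w. B n w = 0 \<Longrightarrow> inner (u n) w = 0"
    and v: "\<And>n. B0 (v n) = f n" "\<And>n w. B0 w = 0 \<Longrightarrow> inner (v n) w = 0"
  shows "(\<lambda>n. j (u n) - j (v n)) \<longlonglongrightarrow> 0"
proof (rule LIMSEQ_if_subsequences)
  fix r :: "nat \<Rightarrow> nat"
  assume r: "strict_mono r"
  interpret limit: coercive_mod_compact "\<lambda>n. B0" B0 K \<mu>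
    by (rule constant_limit_sequence)
  note limit_gap = limit.constant_no_kernel_escape
  obtain s :: "nat \<Rightarrow> nat" and f0 where s: "strict_mono s" and f0: "(\<lambda>n. f (r (s n))) \<longlonglongrightarrow> f0"
    using relatively_compact_seqD[OF f r] .
  have rs: "strict_mono (\<lambda>n. r (s n))"
    using r s by (simp add: strict_mono_def)
  interpret sub: coercive_mod_compact "\<lambda>n. B (r (s n))" B0 K \<mu>
    by (rule subsequence[OF rs])
  \<comment> \<open>The property passes to subsequences, since it is stated for all of them.\<close>
  have sub_gap: sub.no_kernel_escape
    unfolding sub.no_kernel_escape_def
  proof (intro allI impI)
    fix t :: "nat \<Rightarrow> nat" and v u
    assume "strict_mono t" and *: "\<forall>n w. B (r (s (t n))) w = 0 \<longrightarrow> inner (v n) w = 0"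
        "v \<longlonglongrightarrow> u" "B0 u = 0"
    then have "strict_mono (\<lambda>n. r (s (t n)))"
      using rs by (simp add: strict_mono_def)
    then show "u = 0"
      by (rule no_kernel_escapeD[OF gap _ _ *(2,3)]) (simp add: *(1))
  qed
  have "Bseq (\<lambda>n. f (r (s n)))"
    using f0 by (rule convergentI[THEN convergent_imp_Bseq])
  then have B_u: "Bseq (\<lambda>n. B (r (s n)) (u (r (s n))))" and B_v: "Bseq (\<lambda>n. B0 (v (r (s n))))"
    by (simp_all add: u v)
  have Bseq_u: "Bseq (\<lambda>n. u (r (s n)))"
    by (rule sub.Bseq_if_orthogonal_to_kernels[OF sub_gap _ B_u]) (rule u)
  have Bseq_v: "Bseq (\<lambda>n. v (r (s n)))"
    by (rule limit.Bseq_if_orthogonal_to_kernels[OF limit_gap _ B_v]) (rule v)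
  have "(\<lambda>n. B (r (s n)) (u (r (s n)))) \<longlonglongrightarrow> f0"
    using f0 by (simp add: u)
  then obtain t1 :: "nat \<Rightarrow> nat" and u0
    where t1: "strict_mono t1" and u0: "(\<lambda>n. u (r (s (t1 n)))) \<longlonglongrightarrow> u0" "B0 u0 = f0"
    by (rule sub.convergent_subsequence[OF Bseq_u])
  have "(\<lambda>n. B0 (v (r (s (t1 n))))) \<longlonglongrightarrow> f0"
    using LIMSEQ_subseq_LIMSEQ[OF f0 t1] by (simp add: comp_def v)
  then obtain t2 :: "nat \<Rightarrow> nat" and v0
    where t2: "strict_mono t2" and v0: "(\<lambda>n. v (r (s (t1 (t2 n))))) \<longlonglongrightarrow> v0" "B0 v0 = f0"
    by (rule limit.convergent_subsequence[OF Bseq_subseq[OF Bseq_v, of t1]])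
  have u0': "(\<lambda>n. u (r (s (t1 (t2 n))))) \<longlonglongrightarrow> u0"
    using LIMSEQ_subseq_LIMSEQ[OF u0(1) t2] by (simp add: comp_def)
  have "B0 (u0 - v0) = 0"
    using u0 v0 by (simp add: linear_diff[OF bounded_linear.linear[OF lin0]])
  then have "j (u0 - v0) = 0"
    by (rule ker)
  then have "j u0 - j v0 = 0"
    by (simp add: linear_diff[OF bounded_linear.linear[OF j]])
  moreover have "(\<lambda>n. j (u (r (s (t1 (t2 n))))) - j (v (r (s (t1 (t2 n)))))) \<longlonglongrightarrow> j u0 - j v0"
    by (intro tendsto_diff bounded_linear.tendsto[OF j] u0' v0)
  ultimately have "(\<lambda>n. j (u (r (s (t1 (t2 n))))) - j (v (r (s (t1 (t2 n)))))) \<longlonglongrightarrow> 0"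
    by simp
  moreover have "strict_mono (\<lambda>n. s (t1 (t2 n)))"
    using s t1 t2 by (simp add: strict_mono_def)
  ultimately show "\<exists>s. strict_mono s \<and> (\<lambda>n. j (u (r (s n))) - j (v (r (s n)))) \<longlonglongrightarrow> 0"
    by blast
qed

end

section \<open>Complex inner product spaces\<close>

lemma cinner_add_right: "cinner x (y + z) = cinner x y + cinner x (z :: 'a :: complex_inner)"
  by (metis cinner_add_left cinner_commute complex_cnj_add)

lemma cinner_scaleC_right: "cinner x (c *\<^sub>C y) = cnj c * cinner x (y :: 'a :: complex_inner)"
  by (metis cinner_commute cinner_scaleC_left complex_cnj_mult)

lemma scaleC_minus1: "(-1) *\<^sub>C x = - (x :: 'a :: complex_inner)"
  using scaleC_of_real[of "-1" x] by simp

lemma cinner_diff_left: "cinner (x - y) z = cinner x z - cinner y (z :: 'a :: complex_inner)"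
  using cinner_add_left[of x "(-1) *\<^sub>C y" z] cinner_scaleC_left[of "-1" y z] by (simp add: scaleC_minus1)

lemma cinner_scaleR_left: "cinner (r *\<^sub>R x) y = of_real r * cinner x (y :: 'a :: complex_inner)"
  using cinner_scaleC_left[of "of_real r" x y] by (simp add: scaleC_of_real)

lemma cinner_scaleR_right: "cinner x (r *\<^sub>R y) = of_real r * cinner x (y :: 'a :: complex_inner)"
  using cinner_scaleC_right[of x "of_real r" y] by (simp add: scaleC_of_real)

lemma cinner_zero_left [simp]: "cinner 0 (x :: 'a :: complex_inner) = 0"
  using cinner_scaleR_left[of 0 0 x] by simp

lemma cinner_zero_right [simp]: "cinner (x :: 'a :: complex_inner) 0 = 0"
  using cinner_scaleR_right[of x 0 0] by simp

lemma cinner_self_eq_0 [simp]: "cinner x x = 0 \<longleftrightarrow> x = (0 :: 'a :: complex_inner)"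
  by (simp add: cinner_self)

lemma norm_scaleC [simp]: "norm (c *\<^sub>C x) = cmod c * norm (x :: 'a :: complex_inner)"
proof -
  have "cnj c * c = complex_of_real ((cmod c)\<^sup>2)"
    by (simp only: complex_norm_square mult.commute)
  then have "complex_of_real ((norm (c *\<^sub>C x))\<^sup>2) = complex_of_real ((cmod c * norm x)\<^sup>2)"
    unfolding cinner_self[symmetric] cinner_scaleC_left cinner_scaleC_right
    by (simp add: cinner_self power_mult_distrib mult.assoc[symmetric])
  then have "(norm (c *\<^sub>C x))\<^sup>2 = (cmod c * norm x)\<^sup>2"
    by (simp only: of_real_eq_iff)
  then show ?thesis
    by (simp add: power2_eq_iff_nonneg)
qed

lemma Im_cinner: "Im (cinner x y) = inner x (\<i> *\<^sub>C (y :: 'a :: complex_inner))"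
  by (simp add: cinner_scaleC_right flip: Re_cinner)

lemma bounded_bilinear_scaleC: "bounded_bilinear (scaleC :: complex \<Rightarrow> 'a \<Rightarrow> 'a :: complex_inner)"
proof
  fix r and c :: complex and x y :: 'a
  show "(r *\<^sub>R c) *\<^sub>C x = r *\<^sub>R (c *\<^sub>C x)"
    by (simp add: scaleC_scaleC scaleR_conv_of_real flip: scaleC_of_real)
  show "c *\<^sub>C (r *\<^sub>R x) = r *\<^sub>R (c *\<^sub>C x)"
    by (simp add: scaleC_scaleC mult.commute flip: scaleC_of_real)
  show "\<exists>K. \<forall>c (x :: 'a). norm (c *\<^sub>C x) \<le> norm c * norm x * K"
    by (intro exI[of _ 1]) simp
qed (simp_all add: scaleC_add_left scaleC_add_right)

lemma bounded_bilinear_cinner: "bounded_bilinear (cinner :: 'a \<Rightarrow> 'a :: complex_inner \<Rightarrow> complex)"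
proof
  show "\<exists>K. \<forall>x (y :: 'a). norm (cinner x y) \<le> norm x * norm y * K"
  proof (intro exI allI)
    fix x y :: 'a
    have "cmod (cinner x y) \<le> \<bar>Re (cinner x y)\<bar> + \<bar>Im (cinner x y)\<bar>"
      by (rule cmod_le)
    also have "\<dots> \<le> norm x * norm y + norm x * norm (\<i> *\<^sub>C y)"
      unfolding Re_cinner Im_cinner by (intro add_mono Cauchy_Schwarz_ineq2)
    finally show "cmod (cinner x y) \<le> norm x * norm y * 2"
      by simp
  qed
qed (simp_all add: cinner_add_left cinner_add_right cinner_scaleR_left cinner_scaleR_right
    scaleR_conv_of_real)

lemma clinear_imp_linear:
  assumes "clinear f"
  shows "linear f"
proof -
  interpret Vector_Spaces.linear "(*\<^sub>C)" "(*\<^sub>C)" f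
    by fact
  show ?thesis
    by (rule linearI) (simp_all add: add scale flip: scaleC_of_real)
qed

text \<open>For complex subspaces, real and complex orthogonality agree, as the imaginary part of the inner product is the
real inner product with \<open>\<i> *\<^sub>C w\<close>.\<close>

lemma orthogonal_to_csubspace:
  fixes x :: "'a :: complex_inner"
  assumes "complex_vector.subspace W" "\<And>w. w \<in> W \<Longrightarrow> inner x w = 0" "w \<in> W"
  shows "cinner x w = 0"
proof (rule complex_eqI)
  show "Re (cinner x w) = Re 0"
    using assms by (simp add: Re_cinner)
  show "Im (cinner x w) = Im 0"
    using assms complex_vector.subspace_scale[OF assms(1,3), of \<i>] by (simp add: Im_cinner)
qed

lemma cinner_span_eq_0:
  assumes "\<And>e. e \<in> E \<Longrightarrow> cinner x e = 0" and "v \<in> complex_vector.span E"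
  shows "cinner x v = 0"
  using assms(2)
proof (induction rule: complex_vector.span_induct_alt)
  case (step c y z)
  then show ?case
    using assms(1) by (simp add: cinner_add_right cinner_scaleC_right)
qed simp

text \<open>One step of Gram--Schmidt: project onto the component \<open>a - q\<close> of the new vector orthogonal to the old span. If
\<open>a - q\<close> is 0, then the coefficient is the junk value of a division by 0, multiplied by the zero vector.\<close>

lemma projection_onto_finite_span:
  fixes E :: "'a :: complex_inner set"
  assumes "finite E"
  shows "\<exists>p\<in>complex_vector.span E. \<forall>e\<in>E. cinner (x - p) e = 0"
  using assms
proof (induction E arbitrary: x)
  case empty
  show ?case
    by (auto intro: complex_vector.span_zero)
next
  case (insert a E)
  obtain p where p: "p \<in> complex_vector.span E" "\<And>e. e \<in> E \<Longrightarrow> cinner (x - p) e = 0"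
    using insert.IH[of x] by blast
  obtain q where q: "q \<in> complex_vector.span E" "\<And>e. e \<in> E \<Longrightarrow> cinner (a - q) e = 0"
    using insert.IH[of a] by blast
  define c where "c = cinner (x - p) (a - q) / cinner (a - q) (a - q)"
  define p' where "p' = p + c *\<^sub>C (a - q)"
  have sub: "complex_vector.span E \<subseteq> complex_vector.span (insert a E)"
    by (rule complex_vector.span_mono) blast
  have "p' \<in> complex_vector.span (insert a E)"
    unfolding p'_def using p(1) q(1) sub
    by (intro complex_vector.span_add complex_vector.span_scale complex_vector.span_diff)
      (auto intro: complex_vector.span_base)
  moreover have orth: "cinner (x - p') e = 0" if "e \<in> E" for e
    using p(2)[OF that] q(2)[OF that]
    by (simp add: p'_def diff_diff_eq[symmetric] cinner_diff_left[of "x - p"] cinner_scaleC_left)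
  moreover have "cinner (x - p') a = 0"
  proof -
    have "cinner (x - p') (a - q) = 0"
      by (cases "a - q = 0")
        (simp_all add: p'_def c_def diff_diff_eq[symmetric] cinner_diff_left[of "x - p"] cinner_scaleC_left)
    moreover have "cinner (x - p') q = 0"
      using orth q(1) by (rule cinner_span_eq_0)
    ultimately show ?thesis
      using cinner_add_right[of "x - p'" "a - q" q] by simp
  qed
  ultimately show ?case
    by blast
qed

text \<open>A homogeneous linear system with more unknowns than equations has a nonzero solution. The equations are encoded by
the linear map \<open>g\<close> from the span of \<open>F\<close> into the span of \<open>E\<close> that projects orthogonally; it cannot be injective.\<close>

lemma exists_orthogonal_in_span:
  fixes E F :: "'a :: complex_inner set"
  assumes "finite E" and "finite F" and "complex_vector.independent F" and "card E < card F"
  obtains z where "z \<in> complex_vector.span F" "z \<noteq> 0" "\<And>e. e \<in> E \<Longrightarrow> cinner z e = 0"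
proof -
  have "\<forall>x. \<exists>p. p \<in> complex_vector.span E \<and> (\<forall>e\<in>E. cinner (x - p) e = 0)"
    using projection_onto_finite_span[OF \<open>finite E\<close>] by blast
  from choice[OF this] obtain P
    where P: "\<And>x. P x \<in> complex_vector.span E" "\<And>x e. e \<in> E \<Longrightarrow> cinner (x - P x) e = 0"
    by blast
  interpret vector_space_pair "(*\<^sub>C) :: complex \<Rightarrow> 'a \<Rightarrow> 'a" "(*\<^sub>C) :: complex \<Rightarrow> 'a \<Rightarrow> 'a" ..
  obtain g where g: "clinear g" "\<And>x. x \<in> F \<Longrightarrow> g x = P x"
    using linear_independent_extend[OF assms(3), of P] by blast
  interpret g: Vector_Spaces.linear "(*\<^sub>C)" "(*\<^sub>C)" g
    by (rule g(1))
  have orth: "cinner (x - g x) e = 0" if "x \<in> complex_vector.span F" "e \<in> E" for x e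
    using that(1)
  proof (induction rule: complex_vector.span_induct_alt)
    case base
    show ?case
      by (simp add: g.zero)
  next
    case (step c y z)
    have "(c *\<^sub>C y + z) - g (c *\<^sub>C y + z) = c *\<^sub>C (y - g y) + (z - g z)"
      by (simp add: g.add g.scale complex_vector.scale_right_diff_distrib)
    moreover have "cinner (y - g y) e = 0"
      using P(2)[OF that(2)] g(2)[OF step(1)] by simp
    ultimately show ?case
      using step by (simp only: cinner_add_left cinner_scaleC_left) simp
  qed
  have "\<not> inj_on g (complex_vector.span F)"
  proof
    assume inj: "inj_on g (complex_vector.span F)"
    then have "complex_vector.independent (g ` F)"
      by (rule linear_independent_injective_image[OF g(1) assms(3)])
    moreover have "g ` F \<subseteq> complex_vector.span E"
      using g(2) P(1) by auto
    ultimately have "card (g ` F) \<le> card E"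
      using complex_vector.independent_span_bound[OF \<open>finite E\<close>] by blast
    moreover have "card (g ` F) = card F"
      using inj complex_vector.span_superset by (intro card_image) (rule inj_on_subset)
    ultimately show False
      using assms(4) by simp
  qed
  then obtain z where "z \<in> complex_vector.span F" "z \<noteq> 0" "g z = 0"
    unfolding g.inj_on_iff_eq_0[OF complex_vector.subspace_span] by blast
  then show thesis
    using orth[of z] by (intro that[of z]) auto
qed

text \<open>Cover the unit sphere of \<open>W\<close> by finitely many balls of radius 1. A unit vector of \<open>W\<close> orthogonal to all
centres would be at distance \<open>sqrt 2\<close> from each of them, so the centres span \<open>W\<close>.\<close>

lemma finite_basis_if_sphere_compact:
  fixes W :: "'a :: complex_inner set"
  assumes W: "complex_vector.subspace W" and "compact (W \<inter> sphere 0 1)"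
  obtains E where "finite E" "E \<subseteq> W" "W \<subseteq> complex_vector.span E" "card E = cdim W"
proof -
  have "seq_compact (W \<inter> sphere 0 1)"
    using assms(2) by (rule compact_imp_seq_compact)
  then obtain T where T: "finite T" "T \<subseteq> W \<inter> sphere 0 1" "W \<inter> sphere 0 1 \<subseteq> (\<Union>x\<in>T. ball x 1)"
    using seq_compact_imp_totally_bounded[of "W \<inter> sphere 0 1"] by (metis zero_less_one)
  have "W \<subseteq> complex_vector.span T"
  proof
    fix x
    assume "x \<in> W"
    obtain p where p: "p \<in> complex_vector.span T" "\<And>e. e \<in> T \<Longrightarrow> cinner (x - p) e = 0"
      using projection_onto_finite_span[OF T(1), of x] by blast
    have "complex_vector.span T \<subseteq> W"
      using T(2) by (intro complex_vector.span_minimal W) blast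
    then have "x - p \<in> W"
      using \<open>x \<in> W\<close> p(1) by (auto intro: complex_vector.subspace_diff[OF W])
    have "x - p = 0"
    proof (rule ccontr)
      assume "x - p \<noteq> 0"
      define y where "y = complex_of_real (inverse (norm (x - p))) *\<^sub>C (x - p)"
      have "y \<in> W" "norm y = 1"
        using \<open>x - p \<in> W\<close> \<open>x - p \<noteq> 0\<close> by (auto simp: y_def norm_inverse intro: complex_vector.subspace_scale[OF W])
      then obtain e where e: "e \<in> T" "dist e y < 1"
        using T(3) by auto
      have "norm e = 1"
        using e(1) T(2) by auto
      have "inner y e = 0"
        using p(2)[OF e(1)] by (simp add: y_def cinner_scaleC_left flip: Re_cinner)
      then have "(dist e y)\<^sup>2 = (norm e)\<^sup>2 + (norm y)\<^sup>2"
        by (simp add: dist_norm power2_norm_eq_inner inner_diff_left inner_diff_right inner_commute[of e y])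
      then have "1 \<le> (dist e y)\<^sup>2"
        using \<open>norm e = 1\<close> \<open>norm y = 1\<close> by simp
      with e(2) show False
        using power_le_one[of "dist e y" 2] abs_square_less_1[of "dist e y"] by simp
    qed
    with p(1) show "x \<in> complex_vector.span T"
      by simp
  qed
  moreover obtain E where E: "E \<subseteq> W" "complex_vector.independent E" "W \<subseteq> complex_vector.span E" "card E = cdim W"
    by (rule complex_vector.basis_exists)
  ultimately have "finite E"
    using complex_vector.independent_span_bound[OF T(1)] by (meson order_trans)
  with E show thesis
    by (intro that)
qed

text \<open>Adjoining \<open>u\<close> to \<open>W\<close> produces one dimension more than there are orthogonality conditions from \<open>E\<close>. The
assumption \<open>0 < card E\<close> guarantees that \<open>cdim W = card E\<close> expresses a true dimension, because
infinite-dimensional spaces have \<open>cdim\<close> equal to 0.\<close>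

lemma unit_vector_in_enlarged_subspace:
  fixes u :: "'a :: complex_inner"
  assumes W: "complex_vector.subspace W" and orth: "\<And>w. w \<in> W \<Longrightarrow> inner u w = 0" and "u \<noteq> 0"
    and "finite E" and "0 < card E" and dim: "cdim W = card E"
  shows "\<exists>w c. w \<in> W \<and> norm (w + c *\<^sub>C u) = 1 \<and> (\<forall>e\<in>E. cinner (w + c *\<^sub>C u) e = 0)
    \<and> norm w \<le> 1 \<and> cmod c * norm u \<le> 1"
proof -
  obtain F where F: "F \<subseteq> W" "complex_vector.independent F" "W \<subseteq> complex_vector.span F" "card F = cdim W"
    by (rule complex_vector.basis_exists)
  have "finite F"
    using F(4) dim \<open>0 < card E\<close> by (auto intro: card_ge_0_finite)
  have spanF: "complex_vector.span F \<subseteq> W"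
    by (rule complex_vector.span_minimal[OF F(1) W])
  have "u \<notin> W"
    using orth[of u] \<open>u \<noteq> 0\<close> by auto
  then have "u \<notin> complex_vector.span F" and "u \<notin> F"
    using spanF F(1) by auto
  have "complex_vector.independent (insert u F)"
    using F(2) \<open>u \<notin> complex_vector.span F\<close> by (simp add: complex_vector.independent_insert)
  moreover have "card E < card (insert u F)"
    using F(4) dim \<open>finite F\<close> \<open>u \<notin> F\<close> by simp
  ultimately obtain z where z: "z \<in> complex_vector.span (insert u F)" "z \<noteq> 0" "\<And>e. e \<in> E \<Longrightarrow> cinner z e = 0"
    using exists_orthogonal_in_span[of E "insert u F"] \<open>finite E\<close> \<open>finite F\<close> by blast
  obtain b where b: "z - b *\<^sub>C u \<in> complex_vector.span F"
    using z(1) unfolding complex_vector.span_insert by blast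
  define t where "t = complex_of_real (inverse (norm z))"
  define w where "w = t *\<^sub>C (z - b *\<^sub>C u)"
  define c where "c = t * b"
  have sum: "w + c *\<^sub>C u = t *\<^sub>C z"
    by (simp add: w_def c_def complex_vector.scale_right_diff_distrib)
  have "w \<in> W"
    using b spanF unfolding w_def by (intro complex_vector.subspace_scale[OF W]) blast
  have norm1: "norm (w + c *\<^sub>C u) = 1"
    using z(2) by (simp add: sum t_def norm_inverse)
  have "cinner u w = 0"
    by (rule orthogonal_to_csubspace[OF W orth \<open>w \<in> W\<close>])
  then have "inner (c *\<^sub>C u) w = 0"
    by (simp add: cinner_scaleC_left flip: Re_cinner)
  then have "(norm (w + c *\<^sub>C u))\<^sup>2 = (norm w)\<^sup>2 + (norm (c *\<^sub>C u))\<^sup>2"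
    by (intro norm_add_Pythagorean) (simp add: orthogonal_def inner_commute)
  then have sq: "(norm w)\<^sup>2 + (norm (c *\<^sub>C u))\<^sup>2 = 1"
    by (simp only: norm1 one_power2)
  have le1: "p \<le> 1" if "p\<^sup>2 + q\<^sup>2 = 1" for p q :: real
  proof (rule power2_le_imp_le)
    show "p\<^sup>2 \<le> 1\<^sup>2"
      using that zero_le_power2[of q] unfolding one_power2 by linarith
  qed simp
  have "norm w \<le> 1" "norm (c *\<^sub>C u) \<le> 1"
    using le1[OF sq] le1[OF trans[OF add.commute sq]] by simp_all
  then show ?thesis
    using norm1 \<open>w \<in> W\<close> z(3) by (intro exI[of _ w] exI[of _ c]) (simp add: sum cinner_scaleC_left)
qed

text \<open>Suppose that vectors \<open>u n\<close> orthogonal to \<open>W (r n)\<close> converge to a nonzero \<open>u0\<close> in \<open>W0\<close>. Then \<open>W (r n)\<close> together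
with \<open>u n\<close> spans a space of dimension \<open>dim W0 + 1\<close> for large \<open>n\<close>, which therefore contains a unit vector
orthogonal to \<open>W0\<close>. Its two components are bounded and subconverge to elements of \<open>W0\<close>, so a unit vector of \<open>W0\<close>
would be orthogonal to \<open>W0\<close>.\<close>

lemma no_escape_if_dimensions_converge:
  fixes W :: "nat \<Rightarrow> 'a :: complex_inner set" and r :: "nat \<Rightarrow> nat"
  assumes W: "\<And>n. complex_vector.subspace (W n)" and W0: "complex_vector.subspace W0"
    and "compact (W0 \<inter> sphere 0 1)"
    and dim: "(\<lambda>n. cdim (W n)) \<longlonglongrightarrow> cdim W0"
    and limits: "\<And>r w. strict_mono (r :: nat \<Rightarrow> nat) \<Longrightarrow> (\<And>n. w n \<in> W (r n)) \<Longrightarrow> Bseq w \<Longrightarrow>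
      \<exists>(s :: nat \<Rightarrow> nat) w0. strict_mono s \<and> (\<lambda>n. w (s n)) \<longlonglongrightarrow> w0 \<and> w0 \<in> W0"
    and r: "strict_mono r" and orth: "\<And>n w. w \<in> W (r n) \<Longrightarrow> inner (u n) w = 0"
    and u: "u \<longlonglongrightarrow> u0" and "u0 \<in> W0"
  shows "u0 = 0"
proof (rule ccontr)
  assume "u0 \<noteq> 0"
  obtain E where E: "finite E" "E \<subseteq> W0" "W0 \<subseteq> complex_vector.span E" "card E = cdim W0"
    by (rule finite_basis_if_sphere_compact[OF W0 assms(3)])
  have "E \<noteq> {}"
    using E(3) \<open>u0 \<in> W0\<close> \<open>u0 \<noteq> 0\<close> by auto
  then have "0 < card E"
    using E(1) by (simp add: card_gt_0_iff)
  have "eventually (\<lambda>n. cdim (W (r n)) = card E) sequentially"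
    using LIMSEQ_subseq_LIMSEQ[OF dim r] by (simp add: comp_def tendsto_discrete E(4))
  moreover have "eventually (\<lambda>n. norm u0 / 2 < norm (u n)) sequentially"
    using \<open>u0 \<noteq> 0\<close> by (intro order_tendstoD(1)[OF tendsto_norm[OF u]]) simp
  ultimately obtain N where N: "\<And>n. n \<ge> N \<Longrightarrow> cdim (W (r n)) = card E \<and> norm u0 / 2 < norm (u n)"
    using eventually_conj unfolding eventually_sequentially by (smt (verit) le_trans nat_le_linear)
  \<comment> \<open>Pass to a tail on which the dimensions agree and \<open>u n\<close> stays away from 0; the latter bounds the
      coefficients \<open>c\<close> below.\<close>
  define v where "v k = u (k + N)" for k
  define m where "m k = r (k + N)" for k
  have m: "strict_mono m"
    using r by (simp add: m_def strict_mono_def)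
  have v: "v \<longlonglongrightarrow> u0"
    unfolding v_def using u by (rule LIMSEQ_ignore_initial_segment)
  have v_large: "norm u0 / 2 < norm (v k)" for k
    using N[of "k + N"] by (simp add: v_def)
  have "\<exists>w c. w \<in> W (m k) \<and> norm (w + c *\<^sub>C v k) = 1 \<and> (\<forall>e\<in>E. cinner (w + c *\<^sub>C v k) e = 0)
      \<and> norm w \<le> 1 \<and> cmod c * norm (v k) \<le> 1" for k
  proof -
    have "v k \<noteq> 0"
      using v_large[of k] norm_ge_zero[of u0] by auto
    have "cdim (W (m k)) = card E"
      using N[of "k + N"] by (simp add: m_def)
    have orth_v: "inner (v k) w = 0" if "w \<in> W (m k)" for w
      using that orth by (simp add: v_def m_def)
    show ?thesis
      by (rule unit_vector_in_enlarged_subspace[OF W orth_v \<open>v k \<noteq> 0\<close> E(1) \<open>0 < card E\<close>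
            \<open>cdim (W (m k)) = card E\<close>])
  qed
  then obtain w c where w: "\<And>k. w k \<in> W (m k)" and norm1: "\<And>k. norm (w k + c k *\<^sub>C v k) = 1"
    and orthE: "\<And>k e. e \<in> E \<Longrightarrow> cinner (w k + c k *\<^sub>C v k) e = 0"
    and norm_w: "\<And>k. norm (w k) \<le> 1" and norm_c: "\<And>k. cmod (c k) * norm (v k) \<le> 1"
    by metis
  have "cmod (c k) \<le> 2 / norm u0" for k
  proof -
    have "cmod (c k) * (norm u0 / 2) \<le> cmod (c k) * norm (v k)"
      using v_large[of k] by (intro mult_left_mono) auto
    with norm_c[of k] have "cmod (c k) * (norm u0 / 2) \<le> 1"
      by linarith
    then show ?thesis
      using \<open>u0 \<noteq> 0\<close> by (simp add: field_simps)
  qed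
  then have "bounded (range c)"
    by (intro boundedI) auto
  then obtain c0 and s :: "nat \<Rightarrow> nat" where s: "strict_mono s" and c0: "(\<lambda>k. c (s k)) \<longlonglongrightarrow> c0"
    using bounded_imp_convergent_subsequence[of c] by (auto simp: comp_def)
  have ms: "strict_mono (\<lambda>k. m (s k))"
    using m s by (simp add: strict_mono_def)
  have "Bseq (\<lambda>k. w (s k))"
    using norm_w by (rule BseqI')
  then obtain t :: "nat \<Rightarrow> nat" and w0
    where t: "strict_mono t" and w0: "(\<lambda>k. w (s (t k))) \<longlonglongrightarrow> w0" "w0 \<in> W0"
    using limits[OF ms, of "\<lambda>k. w (s k)"] w by blast
  have st: "strict_mono (\<lambda>k. s (t k))"
    using s t by (simp add: strict_mono_def)
  have cst: "(\<lambda>k. c (s (t k))) \<longlonglongrightarrow> c0"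
    using LIMSEQ_subseq_LIMSEQ[OF c0 t] by (simp add: comp_def)
  have vst: "(\<lambda>k. v (s (t k))) \<longlonglongrightarrow> u0"
    using LIMSEQ_subseq_LIMSEQ[OF v st] by (simp add: comp_def)
  define z0 where "z0 = w0 + c0 *\<^sub>C u0"
  have z: "(\<lambda>k. w (s (t k)) + c (s (t k)) *\<^sub>C v (s (t k))) \<longlonglongrightarrow> z0"
    unfolding z0_def by (intro tendsto_add w0 bounded_bilinear.tendsto[OF bounded_bilinear_scaleC] cst vst)
  have "z0 \<in> W0"
    unfolding z0_def
    by (intro complex_vector.subspace_add[OF W0] complex_vector.subspace_scale[OF W0] w0 \<open>u0 \<in> W0\<close>)
  have "cinner z0 e = 0" if "e \<in> E" for e
  proof -
    have "(\<lambda>k. cinner (w (s (t k)) + c (s (t k)) *\<^sub>C v (s (t k))) e) \<longlonglongrightarrow> cinner z0 e"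
      by (rule bounded_bilinear.tendsto[OF bounded_bilinear_cinner z tendsto_const])
    then show ?thesis
      using orthE[OF that] by (simp add: LIMSEQ_const_iff)
  qed
  then have "cinner z0 v = 0" if "v \<in> complex_vector.span E" for v
    using that by (rule cinner_span_eq_0)
  then have "cinner z0 z0 = 0"
    using \<open>z0 \<in> W0\<close> E(3) by blast
  then have "z0 = 0"
    by simp
  have "(\<lambda>k. norm (w (s (t k)) + c (s (t k)) *\<^sub>C v (s (t k)))) \<longlonglongrightarrow> norm z0"
    using z by (rule tendsto_norm)
  then have "norm z0 = 1"
    by (simp add: norm1 LIMSEQ_const_iff)
  with \<open>z0 = 0\<close> show False
    by simp
qed

section \<open>Adjoints and compact maps\<close>

lemma adjoint_exists:
  fixes f :: "'v::{real_inner, complete_space} \<Rightarrow> 'h::real_inner"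
  assumes "bounded_linear f"
  obtains g where "bounded_linear g" "\<And>y v. inner (g y) v = inner y (f v)"
proof -
  have "bounded_bilinear (\<lambda>(y :: 'h) v. inner y (f v))"
    by (rule bounded_bilinear.comp[OF bounded_bilinear_inner bounded_linear_ident assms])
  then show thesis
    by (rule bounded_bilinear_representation) (rule that)
qed

lemma compact_map_imp_relatively_compact_seq:
  assumes "compact_map f" and "Bseq x"
  shows "relatively_compact_seq (\<lambda>n. f (x n))"
  unfolding relatively_compact_seq_def
proof (intro allI impI)
  fix r :: "nat \<Rightarrow> nat"
  have "bounded (range x)"
    using \<open>Bseq x\<close> by (simp add: Bseq_eq_bounded)
  then have "compact (closure (f ` range x))"
    using assms(1) by (simp add: compact_map_def)
  then have sc: "seq_compact (closure (f ` range x))"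
    by (rule compact_imp_seq_compact)
  have "f (x (r n)) \<in> closure (f ` range x)" for n
    by (intro closure_subset[THEN subsetD]) blast
  then obtain l s where "strict_mono (s :: nat \<Rightarrow> nat)" "((\<lambda>n. f (x (r n))) \<circ> s) \<longlonglongrightarrow> l"
    using seq_compactE[OF sc, of "\<lambda>n. f (x (r n))"] by blast
  then show "\<exists>s. strict_mono s \<and> convergent (\<lambda>n. f (x (r (s n))))"
    by (auto simp: comp_def convergent_def)
qed

lemma compact_map_imp_bounded_linear:
  assumes "clinear f" and "compact_map f"
  shows "bounded_linear f"
proof -
  have lin: "linear f"
    using assms(1) by (rule clinear_imp_linear)
  have "compact (closure (f ` cball 0 1))"
    using assms(2) by (simp add: compact_map_def)
  then have "bounded (f ` cball 0 1)"
    by (meson bounded_subset closure_subset compact_imp_bounded)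
  then obtain C where "\<forall>y\<in>f ` cball 0 1. norm y \<le> C"
    unfolding bounded_iff by blast
  then have C: "norm (f x) \<le> C" if "norm x \<le> 1" for x
    using that by simp
  show ?thesis
  proof (rule bounded_linear_intro[where K = C])
    show "norm (f x) \<le> norm x * C" for x
    proof (cases "x = 0")
      case False
      have "norm (f (x /\<^sub>R norm x)) \<le> C"
        using False by (intro C) simp
      then show ?thesis
        using False by (simp add: linear_scale[OF lin] field_simps)
    qed (simp add: linear_0[OF lin])
  qed (simp_all add: linear_add[OF lin] linear_scale[OF lin])
qed

lemma relatively_compact_seq_bounded_linear:
  assumes "bounded_linear g" and "relatively_compact_seq x"
  shows "relatively_compact_seq (\<lambda>n. g (x n))"
  unfolding relatively_compact_seq_def
proof (intro allI impI)
  fix r :: "nat \<Rightarrow> nat"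
  assume "strict_mono r"
  then obtain s :: "nat \<Rightarrow> nat" and l where s: "strict_mono s" "(\<lambda>n. x (r (s n))) \<longlonglongrightarrow> l"
    by (rule relatively_compact_seqD[OF assms(2)])
  have "(\<lambda>n. g (x (r (s n)))) \<longlonglongrightarrow> g l"
    using s(2) by (rule bounded_linear.tendsto[OF assms(1)])
  then show "\<exists>s. strict_mono s \<and> convergent (\<lambda>n. g (x (r (s n))))"
    using s(1) by (auto simp: convergent_def)
qed

text \<open>Schauder's theorem in a Hilbert space, from \<open>norm (js x)^2 = inner x (j (js x))\<close>: convergence of the images
under \<open>j\<close> already makes \<open>js (y n)\<close> a Cauchy sequence, as \<open>y\<close> is bounded.\<close>

lemma adjoint_of_compact_map:
  fixes j :: "'v::chilbert_space \<Rightarrow> 'h::complex_inner"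
  assumes "linear j" and "compact_map j" and js: "bounded_linear js"
    and adj: "\<And>y v. inner (js y) v = inner y (j v)" and "Bseq y"
  shows "relatively_compact_seq (\<lambda>n. js (y n))"
  unfolding relatively_compact_seq_def
proof (intro allI impI)
  fix r :: "nat \<Rightarrow> nat"
  assume r: "strict_mono r"
  obtain C where C: "C > 0" "\<And>n. norm (y n) \<le> C"
    using \<open>Bseq y\<close> by (rule BseqE) blast
  have "Bseq (\<lambda>n. js (y n))"
  proof -
    obtain M where "M \<ge> 0" "\<And>x. norm (js x) \<le> norm x * M"
      using bounded_linear.nonneg_bounded[OF js] by blast
    then have "norm (js (y n)) \<le> C * M" for n
      using C(2)[of n] by (meson mult_right_mono order_trans)
    then show ?thesis
      by (rule BseqI')
  qed
  then have "relatively_compact_seq (\<lambda>n. j (js (y n)))"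
    by (rule compact_map_imp_relatively_compact_seq[OF \<open>compact_map j\<close>])
  then obtain s :: "nat \<Rightarrow> nat" and l where s: "strict_mono s" and l: "(\<lambda>n. j (js (y (r (s n))))) \<longlonglongrightarrow> l"
    using r by (rule relatively_compact_seqD)
  define z where "z n = js (y (r (s n)))" for n
  have est: "(dist (z m) (z n))\<^sup>2 \<le> 2 * C * dist (j (z m)) (j (z n))" for m n
  proof -
    have "(dist (z m) (z n))\<^sup>2 = inner (y (r (s m)) - y (r (s n))) (j (z m) - j (z n))"
    proof -
      have "z m - z n = js (y (r (s m)) - y (r (s n)))"
        by (simp add: z_def linear_diff[OF bounded_linear.linear[OF js]])
      then have "(dist (z m) (z n))\<^sup>2 = inner (js (y (r (s m)) - y (r (s n)))) (z m - z n)"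
        by (simp add: dist_norm power2_norm_eq_inner)
      also have "\<dots> = inner (y (r (s m)) - y (r (s n))) (j (z m) - j (z n))"
        by (simp only: adj linear_diff[OF \<open>linear j\<close>])
      finally show ?thesis .
    qed
    also have "\<dots> \<le> norm (y (r (s m)) - y (r (s n))) * norm (j (z m) - j (z n))"
      by (rule norm_cauchy_schwarz)
    also have "\<dots> \<le> (2 * C) * norm (j (z m) - j (z n))"
      using norm_triangle_ineq4[of "y (r (s m))" "y (r (s n))"] C(2)[of "r (s m)"] C(2)[of "r (s n)"]
      by (intro mult_right_mono) auto
    finally show ?thesis
      by (simp add: dist_norm)
  qed
  have "Cauchy (\<lambda>n. j (z n))"
    using l unfolding z_def by (rule LIMSEQ_imp_Cauchy)
  have "Cauchy z"
  proof (rule metric_CauchyI)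
    fix e :: real
    assume "e > 0"
    then have "e\<^sup>2 / (2 * C) > 0"
      using C(1) by simp
    from metric_CauchyD[OF \<open>Cauchy (\<lambda>n. j (z n))\<close> this]
    obtain M where M: "\<And>m n. m \<ge> M \<Longrightarrow> n \<ge> M \<Longrightarrow> dist (j (z m)) (j (z n)) < e\<^sup>2 / (2 * C)"
      by blast
    have "dist (z m) (z n) < e" if "m \<ge> M" "n \<ge> M" for m n
    proof -
      have "2 * C * dist (j (z m)) (j (z n)) < e\<^sup>2"
        using M[OF that] C(1) by (simp add: field_simps)
      with est[of m n] have "(dist (z m) (z n))\<^sup>2 < e\<^sup>2"
        by (rule order_le_less_trans)
      then show ?thesis
        using \<open>e > 0\<close> by (simp add: power_less_imp_less_base)
    qed
    then show "\<exists>M. \<forall>m\<ge>M. \<forall>n\<ge>M. dist (z m) (z n) < e"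
      by blast
  qed
  then show "\<exists>s. strict_mono s \<and> convergent (\<lambda>n. js (y (r (s n))))"
    using s Cauchy_convergent unfolding z_def by blast
qed

text \<open>This turns convergence in operator norm into a statement about one bounded sequence of vectors. The factor 2 is
needed as the norm may fail to be attained.\<close>

lemma onorm_almost_attained:
  assumes "bounded_linear f"
  shows "\<exists>y. norm y \<le> 1 \<and> onorm f \<le> 2 * norm (f y)"
proof (cases "onorm f = 0")
  case False
  then have pos: "onorm f > 0"
    using onorm_pos_le[OF assms] by simp
  have "\<not> (\<forall>x. norm (f x) \<le> (onorm f / 2) * norm x)"
    using onorm_bound[of "onorm f / 2" f] pos by auto
  then obtain x where x: "norm (f x) > (onorm f / 2) * norm x"
    by (auto simp: not_le)
  then have "x \<noteq> 0"
    using linear_0[OF bounded_linear.linear[OF assms]] by auto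
  then show ?thesis
    using x by (intro exI[of _ "x /\<^sub>R norm x"])
      (simp add: linear_scale[OF bounded_linear.linear[OF assms]] field_simps)
qed (auto intro!: exI[of _ 0])

section \<open>Forms and their operators\<close>

lemma sesquilinear_simps:
  assumes "sesquilinear b"
  shows "b (u + u') v = b u v + b u' v" "b u (v + v') = b u v + b u v'"
    "b (c *\<^sub>C u) v = c * b u v" "b u (c *\<^sub>C v) = cnj c * b u v"
    "b 0 v = 0" "b u 0 = 0" "b (u - u') v = b u v - b u' v"
proof -
  show add: "b (u + u') v = b u v + b u' v" and "b u (v + v') = b u v + b u v'"
    and scale: "b (c *\<^sub>C u) v = c * b u v" and scale': "b u (c *\<^sub>C v) = cnj c * b u v" for u u' v v' c
    using assms by (simp_all add: sesquilinear_def)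
  show "b 0 v = 0" "b u 0 = 0"
    using scale[of 0 0 v] scale'[of u 0 0] by simp_all
  show "b (u - u') v = b u v - b u' v"
    using add[of u "(-1) *\<^sub>C u'" v] scale[of "-1" u' v] by (simp add: scaleC_minus1)
qed

text \<open>Continuity at the origin bounds \<open>b\<close> on a small bidisc; homogeneity in each argument extends the bound to the whole
space.\<close>

lemma bounded_bilinear_continuous_form:
  fixes b :: "'v::complex_inner form"
  assumes b: "sesquilinear b" and "continuous_form b"
  shows "bounded_bilinear b"
proof
  note sesq = sesquilinear_simps[OF b]
  show "b (r *\<^sub>R u) v = r *\<^sub>R b u v" "b u (r *\<^sub>R v) = r *\<^sub>R b u v" for r u v
    by (simp_all add: sesq scaleR_conv_of_real flip: scaleC_of_real)
  have "isCont (\<lambda>(u, v). b u v) (0, 0)"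
    using assms(2) unfolding continuous_form_def by (simp add: continuous_on_eq_continuous_at)
  then obtain d where d: "d > 0" "\<And>p. norm (p - (0, 0)) < d \<Longrightarrow> norm ((\<lambda>(u, v). b u v) p) < 1"
    using sesq unfolding continuous_at_eps_delta dist_norm by (metis (mono_tags, lifting) case_prod_conv diff_zero zero_less_one)
  have small: "cmod (b u v) \<le> 1" if "norm u \<le> d / 4" "norm v \<le> d / 4" for u v
  proof -
    have "norm (u, v) \<le> norm u + norm v"
      by (rule norm_Pair_le)
    also have "\<dots> < d"
      using that d(1) by linarith
    finally show ?thesis
      using d(2)[of "(u, v)"] by simp
  qed
  show "\<exists>K. \<forall>u v. norm (b u v) \<le> norm u * norm v * K"
  proof (intro exI allI)
    fix u v :: 'v
    show "norm (b u v) \<le> norm u * norm v * (16 / d\<^sup>2)"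
    proof (cases "u = 0 \<or> v = 0")
      case False
      define p where "p = complex_of_real (d / (4 * norm u))"
      define q where "q = complex_of_real (d / (4 * norm v))"
      have "cmod (b (p *\<^sub>C u) (q *\<^sub>C v)) \<le> 1"
        using False d(1) by (intro small) (simp_all add: p_def q_def norm_divide norm_mult)
      moreover have "cmod (b (p *\<^sub>C u) (q *\<^sub>C v)) = (d / (4 * norm u)) * ((d / (4 * norm v)) * cmod (b u v))"
        using d(1) by (simp add: sesq norm_mult p_def q_def norm_divide)
      ultimately have "(d / (4 * norm u)) * ((d / (4 * norm v)) * cmod (b u v)) \<le> 1"
        by simp
      then show ?thesis
        using False d(1) by (simp add: field_simps power2_eq_square)
    qed (auto simp: sesq)
  qed
qed (simp_all add: sesquilinear_simps[OF b])

lemma bounded_bilinear_Re: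
  fixes b :: "'a::real_normed_vector \<Rightarrow> 'b::real_normed_vector \<Rightarrow> complex"
  assumes "bounded_bilinear b"
  shows "bounded_bilinear (\<lambda>u v. Re (b u v))"
proof -
  interpret bounded_bilinear b
    by fact
  obtain K where "\<And>u v. norm (b u v) \<le> norm u * norm v * K"
    using bounded by blast
  then have K: "\<bar>Re (b u v)\<bar> \<le> norm u * norm v * K" for u v
    using abs_Re_le_cmod order_trans by blast
  show ?thesis
    by unfold_locales (auto simp: add_left add_right scaleR_left scaleR_right intro: K)
qed

text \<open>The imaginary part of an antilinear functional is determined by its real part. This is what permits the reduction
of the complex equations to real Hilbert space.\<close>

lemma antilinear_eq_iff_Re_eq:
  fixes f g :: "'v::complex_inner \<Rightarrow> complex"
  assumes "\<And>v. f (\<i> *\<^sub>C v) = - \<i> * f v" "\<And>v. g (\<i> *\<^sub>C v) = - \<i> * g v"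
  shows "(\<forall>v. f v = g v) \<longleftrightarrow> (\<forall>v. Re (f v) = Re (g v))"
proof (intro iffI allI)
  fix v
  assume *: "\<forall>v. Re (f v) = Re (g v)"
  from *[rule_format, of "\<i> *\<^sub>C v"] have "Im (f v) = Im (g v)"
    by (simp add: assms)
  with * show "f v = g v"
    by (intro complex_eqI) simp_all
qed simp

lemma csubspace_form_W:
  assumes "clinear j" and "sesquilinear b"
  shows "complex_vector.subspace (form_W j b)"
proof -
  interpret Vector_Spaces.linear "(*\<^sub>C)" "(*\<^sub>C)" j
    by fact
  show ?thesis
    by (auto simp: complex_vector.subspace_def form_W_def zero add scale sesquilinear_simps[OF assms(2)])
qed

text \<open>Here \<open>d n\<close> represents the error \<open>a_n(v, .) - a(v, .)\<close>. Testing the assumption with constant sequences shows that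
\<open>d\<close> tends to 0 weakly. The normalised errors \<open>u n\<close>, set to 0 where \<open>d n\<close> is already small, then tend to 0
weakly as well, and testing the assumption with them recovers the norm of \<open>d n\<close>. Thus weak convergence of symmetric
forms is strong convergence of their operators.\<close>

lemma forms_converge_strongly:
  fixes a :: "'v::chilbert_space form"
  assumes a: "sesquilinear a" "continuous_form a" "symmetric_form a"
    and a_seq: "\<And>n. symmetric_form (a_seq n)"
    and conv: "forms_converge_weakly a_seq a"
    and d: "\<And>n w. inner (d n) w = Re (a_seq n v w) - Re (a v w)"
  shows "d \<longlonglongrightarrow> 0"
proof (rule tendstoI)
  fix e :: real
  assume e: "e > 0"
  have swap: "Re (a u w) = Re (a w u)" "Re (a_seq n u w) = Re (a_seq n w u)" for n u w
    using a(3) a_seq[of n] unfolding symmetric_form_def by (metis cnj.sel(1))+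
  have pointwise: "(\<lambda>n. inner g (d n)) \<longlonglongrightarrow> 0" for g
  proof -
    have "(\<lambda>n. a_seq n v g) \<longlonglongrightarrow> a v g"
      using conv unfolding forms_converge_weakly_def
      by (elim allE[of _ g] allE[of _ v] allE[of _ "\<lambda>_. v"] mp) (simp add: weakly_tendsto_def)
    then have "(\<lambda>n. Re (a_seq n v g) - Re (a v g)) \<longlonglongrightarrow> Re (a v g) - Re (a v g)"
      by (intro tendsto_intros)
    then show ?thesis
      by (simp add: inner_commute[of g] d)
  qed
  have functional: "(\<lambda>n. \<psi> (d n)) \<longlonglongrightarrow> 0" if \<psi>: "bounded_linear \<psi>" for \<psi> :: "'v \<Rightarrow> real"
  proof -
    obtain g where "\<And>x. \<psi> x = inner g x"
      using Riesz_representation[OF \<psi>] by blast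
    then show ?thesis
      using pointwise[of g] by simp
  qed
  define c where "c n = (if norm (d n) \<ge> e then inverse (norm (d n)) else 0)" for n
  define u where "u n = c n *\<^sub>R d n" for n
  have c: "\<bar>c n\<bar> \<le> inverse e" for n
    using e by (auto simp: c_def intro: le_imp_inverse_le)
  have Bc: "Bseq c"
    using c by (intro BseqI') simp
  have "weakly_tendsto u 0"
    unfolding weakly_tendsto_def
  proof (intro allI impI)
    fix \<phi> :: "'v \<Rightarrow> complex"
    assume "bounded_clinear \<phi>"
    then have bl: "bounded_linear \<phi>"
      by (simp add: bounded_clinear_def)
    have "(\<lambda>n. Re (\<phi> (d n))) \<longlonglongrightarrow> 0" "(\<lambda>n. Im (\<phi> (d n))) \<longlonglongrightarrow> 0"
      by (intro functional bounded_linear_compose[OF bounded_linear_Re bl]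
          bounded_linear_compose[OF bounded_linear_Im bl])+
    then have "(\<lambda>n. \<phi> (d n)) \<longlonglongrightarrow> 0"
      by (simp add: tendsto_complex_iff)
    then have "Zfun (\<lambda>n. c n *\<^sub>R \<phi> (d n)) sequentially"
      using bounded_bilinear.Bfun_prod_Zfun[OF bounded_bilinear_scaleR Bc] by (simp add: tendsto_Zfun_iff)
    then show "(\<lambda>n. \<phi> (u n)) \<longlonglongrightarrow> \<phi> 0"
      by (simp add: u_def linear_scale[OF bounded_linear.linear[OF bl]]
          linear_0[OF bounded_linear.linear[OF bl]] tendsto_Zfun_iff)
  qed
  then have lim: "(\<lambda>n. a_seq n (u n) v) \<longlonglongrightarrow> a 0 v"
    using conv unfolding forms_converge_weakly_def by blast
  have bc: "bounded_clinear (\<lambda>u. a u v)"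
    unfolding bounded_clinear_def
  proof
    show "clinear (\<lambda>u. a u v)"
      by unfold_locales (simp_all add: sesquilinear_simps[OF a(1)] scaleC_complex_def)
    show "bounded_linear (\<lambda>u. a u v)"
      by (rule bounded_bilinear.bounded_linear_left[OF bounded_bilinear_continuous_form[OF a(1,2)]])
  qed
  have "(\<lambda>n. a (u n) v) \<longlonglongrightarrow> a 0 v"
    by (rule \<open>weakly_tendsto u 0\<close>[unfolded weakly_tendsto_def, rule_format, OF bc])
  with lim have "(\<lambda>n. Re (a_seq n (u n) v) - Re (a (u n) v)) \<longlonglongrightarrow> Re (a 0 v) - Re (a 0 v)"
    by (intro tendsto_intros)
  then have "(\<lambda>n. inner (d n) (u n)) \<longlonglongrightarrow> 0"
    by (simp add: d swap[of _ v] swap(2)[of _ v])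
  then have "eventually (\<lambda>n. inner (d n) (u n) < e) sequentially"
    using e by (rule order_tendstoD(2))
  then show "eventually (\<lambda>n. dist (d n) 0 < e) sequentially"
  proof (rule eventually_mono)
    fix n
    assume *: "inner (d n) (u n) < e"
    show "dist (d n) 0 < e"
    proof (rule ccontr)
      assume "\<not> dist (d n) 0 < e"
      then have "norm (d n) \<ge> e"
        by simp
      moreover from this have "d n \<noteq> 0"
        using e by auto
      ultimately have "inner (d n) (u n) = norm (d n)"
        by (simp add: u_def c_def power2_norm_eq_inner[symmetric] power2_eq_square)
      with * \<open>norm (d n) \<ge> e\<close> show False
        by simp
    qed
  qed
qed

section \<open>The resolvent equation\<close>

lemma graph_shift_form_graph_iff:
  "(x, y) \<in> graph_shift (form_graph a j) z \<longleftrightarrow>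
    (\<exists>u. j u = x \<and> (\<forall>v. a u v + z * cinner (j u) (j v) = cinner y (j v)))"
proof -
  have "(x, y) \<in> graph_shift (form_graph a j) z \<longleftrightarrow> (x, y - z *\<^sub>C x) \<in> form_graph a j"
    unfolding graph_shift_def by (auto intro: exI[of _ "y - z *\<^sub>C x"])
  also have "\<dots> \<longleftrightarrow> (\<exists>u. j u = x \<and> (\<forall>v. a u v = cinner y (j v) - z * cinner x (j v)))"
    by (simp add: form_graph_def cinner_diff_left cinner_scaleC_left)
  finally show ?thesis
    by (auto simp: algebra_simps)
qed

text \<open>The resolvent equation for one form at the point \<open>s\<close> as a real linear operator equation \<open>T u = js y\<close>, where \<open>T\<close>
represents the real part of the shifted form and \<open>js\<close> is the adjoint of \<open>j\<close>.\<close>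

locale form_resolvent =
  fixes j :: "'v::chilbert_space \<Rightarrow> 'h::chilbert_space" and a :: "'v form" and s :: real
    and T :: "'v \<Rightarrow> 'v" and js :: "'h \<Rightarrow> 'v"
  assumes j: "clinear j" and a: "sesquilinear a" and sym: "symmetric_form a" and s: "s \<noteq> 0"
    and T: "\<And>u v. inner (T u) v = Re (a u v + \<i> * s * cinner (j u) (j v))"
    and js: "\<And>y v. inner (js y) v = inner y (j v)"
begin

sublocale j: Vector_Spaces.linear "(*\<^sub>C)" "(*\<^sub>C)" j
  by (rule j)

lemma T_eq_iff: "T u = js y \<longleftrightarrow> (\<forall>v. a u v + \<i> * s * cinner (j u) (j v) = cinner y (j v))"
proof -
  have "T u = js y \<longleftrightarrow> (\<forall>v. inner (T u) v = inner (js y) v)"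
    by (simp add: vector_eq_rdot)
  also have "\<dots> \<longleftrightarrow> (\<forall>v. Re (a u v + \<i> * s * cinner (j u) (j v)) = Re (cinner y (j v)))"
    by (simp only: T js Re_cinner)
  also have "\<dots> \<longleftrightarrow> (\<forall>v. a u v + \<i> * s * cinner (j u) (j v) = cinner y (j v))"
    by (rule antilinear_eq_iff_Re_eq[symmetric])
      (simp_all add: sesquilinear_simps[OF a] j.scale cinner_scaleC_right algebra_simps)
  finally show ?thesis .
qed

lemma js_0: "js 0 = 0"
  by (rule vector_eq_rdot[THEN iffD1]) (simp add: js)

lemma Im_a_self: "Im (a u u) = 0"
proof -
  have "a u u = cnj (a u u)"
    using sym unfolding symmetric_form_def by blast
  then have "Im (a u u) = Im (cnj (a u u))"
    by simp
  then show ?thesis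
    by simp
qed

text \<open>Test the equation with \<open>v = u\<close>. The form is real on the diagonal, so the imaginary part consists of the shift
alone.\<close>

lemma norm_j_le:
  assumes "T u = js y"
  shows "norm (j u) \<le> norm y / \<bar>s\<bar>"
proof (cases "j u = 0")
  case False
  have "Im (a u u + \<i> * s * cinner (j u) (j u)) = Im (cinner y (j u))"
    using assms by (simp add: T_eq_iff)
  then have "s * (norm (j u))\<^sup>2 = inner y (\<i> *\<^sub>C j u)"
    unfolding Im_cinner by (simp add: Im_a_self cinner_self)
  then have "\<bar>s\<bar> * (norm (j u))\<^sup>2 = \<bar>inner y (\<i> *\<^sub>C j u)\<bar>"
    by (metis abs_mult abs_power2)
  also have "\<dots> \<le> norm y * norm (\<i> *\<^sub>C j u)"
    by (rule Cauchy_Schwarz_ineq2)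
  finally have "(\<bar>s\<bar> * norm (j u)) * norm (j u) \<le> norm y * norm (j u)"
    by (simp add: power2_eq_square mult.assoc)
  then show ?thesis
    using False s by (simp add: field_simps)
qed simp

lemma T_eq_0_iff: "T u = 0 \<longleftrightarrow> u \<in> form_W j a"
proof
  assume "T u = 0"
  then have T0: "T u = js 0"
    by (simp add: js_0)
  then have "j u = 0"
    using norm_j_le[OF T0] by simp
  with T0 show "u \<in> form_W j a"
    by (simp add: T_eq_iff form_W_def)
next
  assume "u \<in> form_W j a"
  then have "T u = js 0"
    by (simp add: T_eq_iff form_W_def)
  then show "T u = 0"
    by (simp add: js_0)
qed

text \<open>The kernel of the adjoint, which belongs to the shift \<open>- s\<close>, is again the space \<open>form_W\<close>; hence the right-hand
sides \<open>js y\<close> are always admissible.\<close>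

lemma orthogonal_to_range_T:
  assumes "\<And>u. inner (T u) g = 0"
  shows "g \<in> form_W j a"
proof -
  define h where "h u = a u g + \<i> * s * cinner (j u) (j g)" for u
  have Re: "Re (h u) = 0" for u
    using assms[of u] by (simp add: T h_def)
  have h0: "h u = 0" for u
  proof -
    have "h (\<i> *\<^sub>C u) = \<i> * h u"
      by (simp add: h_def sesquilinear_simps[OF a] j.scale cinner_scaleC_left algebra_simps)
    then have "Im (h u) = - Re (h (\<i> *\<^sub>C u))"
      by simp
    then show ?thesis
      by (simp add: complex_eq_iff Re)
  qed
  from h0[of g] have "Im (h g) = 0"
    by simp
  then have "j g = 0"
    using s by (simp add: h_def Im_a_self cinner_self)
  moreover have "a g v = 0" for v
  proof -
    have "a v g = 0"
      using h0[of v] \<open>j g = 0\<close> by (simp add: h_def)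
    then show ?thesis
      using sym unfolding symmetric_form_def by (metis complex_cnj_zero)
  qed
  ultimately show ?thesis
    by (simp add: form_W_def)
qed

lemma graph_shift_iff:
  "(x, y) \<in> graph_shift (form_graph a j) (\<i> * s) \<longleftrightarrow> (\<exists>u. j u = x \<and> T u = js y)"
  by (simp add: graph_shift_form_graph_iff T_eq_iff)

lemma j_eq:
  assumes "T u = js y" "T u' = js y"
  shows "j u = j u'"
proof -
  have "a u v + \<i> * s * cinner (j u) (j v) = a u' v + \<i> * s * cinner (j u') (j v)" for v
    using assms by (simp add: T_eq_iff)
  then have "T (u - u') = js 0"
    by (simp add: T_eq_iff sesquilinear_simps[OF a] j.diff cinner_diff_left algebra_simps)
  from norm_j_le[OF this] show ?thesis
    by (simp add: j.diff)
qed

lemma graph_inverse_eq: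
  assumes "T u = js y"
  shows "graph_inverse (graph_shift (form_graph a j) (\<i> * s)) y = j u"
  unfolding graph_inverse_def
proof (rule the_equality)
  show "(j u, y) \<in> graph_shift (form_graph a j) (\<i> * s)"
    using assms by (auto simp: graph_shift_iff)
  show "x = j u" if "(x, y) \<in> graph_shift (form_graph a j) (\<i> * s)" for x
    using that j_eq[OF _ assms] by (auto simp: graph_shift_iff)
qed

text \<open>The solution \<open>u\<close> is only determined up to \<open>form_W\<close>, but \<open>j u\<close> is unique and depends linearly and boundedly on
\<open>y\<close>.\<close>

lemma graph_invertible_if_solvable:
  assumes solvable: "\<And>y. \<exists>u. T u = js y"
  shows "graph_invertible (graph_shift (form_graph a j) (\<i> * s))"
proof -
  let ?G = "graph_shift (form_graph a j) (\<i> * s)"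
  have add: "graph_inverse ?G (x + y) = graph_inverse ?G x + graph_inverse ?G y" for x y
  proof -
    obtain u w where u: "T u = js x" and w: "T w = js y"
      using solvable by meson
    have "a (u + w) v + \<i> * s * cinner (j (u + w)) (j v) = cinner (x + y) (j v)" for v
    proof -
      have "a (u + w) v + \<i> * s * cinner (j (u + w)) (j v)
          = (a u v + \<i> * s * cinner (j u) (j v)) + (a w v + \<i> * s * cinner (j w) (j v))"
        by (simp add: sesquilinear_simps[OF a] j.add cinner_add_left algebra_simps)
      also have "\<dots> = cinner (x + y) (j v)"
        using u w by (simp add: T_eq_iff cinner_add_left)
      finally show ?thesis .
    qed
    then have "T (u + w) = js (x + y)"
      by (simp add: T_eq_iff)
    then show ?thesis
      using u w by (simp add: graph_inverse_eq j.add)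
  qed
  have scale: "graph_inverse ?G (c *\<^sub>C x) = c *\<^sub>C graph_inverse ?G x" for c x
  proof -
    obtain u where u: "T u = js x"
      using solvable by meson
    have "a (c *\<^sub>C u) v + \<i> * s * cinner (j (c *\<^sub>C u)) (j v) = cinner (c *\<^sub>C x) (j v)" for v
    proof -
      have "a (c *\<^sub>C u) v + \<i> * s * cinner (j (c *\<^sub>C u)) (j v)
          = c * (a u v + \<i> * s * cinner (j u) (j v))"
        by (simp add: sesquilinear_simps[OF a] j.scale cinner_scaleC_left distrib_left)
      also have "\<dots> = cinner (c *\<^sub>C x) (j v)"
        using u by (simp add: T_eq_iff cinner_scaleC_left)
      finally show ?thesis .
    qed
    then have "T (c *\<^sub>C u) = js (c *\<^sub>C x)"
      by (simp add: T_eq_iff)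
    then show ?thesis
      using u by (simp add: graph_inverse_eq j.scale)
  qed
  have bound: "norm (graph_inverse ?G y) \<le> norm y * (1 / \<bar>s\<bar>)" for y
  proof -
    obtain u where u: "T u = js y"
      using solvable by meson
    then show ?thesis
      using norm_j_le[OF u] by (simp add: graph_inverse_eq)
  qed
  have "clinear (graph_inverse ?G)"
    by unfold_locales (fact add scale)+
  moreover have "bounded_linear (graph_inverse ?G)"
    by (rule bounded_linear_intro[OF add _ bound]) (simp add: scale flip: scaleC_of_real)
  moreover have "\<exists>!x. (x, y) \<in> ?G" for y
  proof -
    obtain u where u: "T u = js y"
      using solvable by meson
    show ?thesis
    proof (rule ex1I[of _ "j u"])
      show "(j u, y) \<in> ?G"
        using u by (auto simp: graph_shift_iff)
      show "x = j u" if "(x, y) \<in> ?G" for x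
        using that j_eq[OF _ u] by (auto simp: graph_shift_iff)
    qed
  qed
  ultimately show ?thesis
    by (simp add: graph_invertible_def bounded_clinear_def)
qed

end

lemma resolvent_operator_exists:
  fixes j :: "'v::chilbert_space \<Rightarrow> 'h::chilbert_space" and a :: "'v form"
  assumes j: "bounded_clinear j" and a: "sesquilinear a" "continuous_form a"
  obtains T where "bounded_linear T" "\<And>u v. inner (T u) v = Re (a u v + z * cinner (j u) (j v))"
proof -
  define b where "b u v = a u v + z * cinner (j u) (j v)" for u v
  have cj: "clinear j" and bj: "bounded_linear j"
    using j by (simp_all add: bounded_clinear_def)
  interpret j: Vector_Spaces.linear "(*\<^sub>C)" "(*\<^sub>C)" j
    by (rule cj)
  have "sesquilinear b"
    by (simp add: sesquilinear_def b_def sesquilinear_simps[OF a(1)] j.add j.scale cinner_add_left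
        cinner_add_right cinner_scaleC_left cinner_scaleC_right algebra_simps)
  moreover have "continuous_form b"
    using a(2) unfolding continuous_form_def b_def case_prod_unfold
    by (intro continuous_intros bounded_bilinear.continuous_on[OF bounded_bilinear_cinner]
        bounded_linear.continuous_on[OF bj])
  ultimately have "bounded_bilinear (\<lambda>u v. Re (b u v))"
    by (intro bounded_bilinear_Re bounded_bilinear_continuous_form)
  then show thesis
    by (rule bounded_bilinear_representation) (rule that, simp_all add: b_def)
qed

section \<open>Convergence of the resolvents\<close>

text \<open>Asymptotic compactness supplies both prerequisites of the dimension argument: the limit kernel has a compact unit
sphere, and bounded sequences in the kernels accumulate in the limit kernel.\<close>

lemma no_kernel_escape_if_dimensions_converge:
  fixes B :: "nat \<Rightarrow> 'v::chilbert_space \<Rightarrow> 'v"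
  assumes "coercive_mod_compact B B0 K \<mu>"
    and sub: "\<And>n. complex_vector.subspace {u. B n u = 0}" and sub0: "complex_vector.subspace {u. B0 u = 0}"
    and dim: "(\<lambda>n. cdim {u. B n u = 0}) \<longlonglongrightarrow> cdim {u. B0 u = 0}"
  shows "coercive_mod_compact.no_kernel_escape B B0"
proof -
  interpret coercive_mod_compact B B0 K \<mu>
    by fact
  interpret limit: coercive_mod_compact "\<lambda>n. B0" B0 K \<mu>
    by (rule constant_limit_sequence)
  have "compact ({u. B0 u = 0} \<inter> sphere 0 1)"
    unfolding compact_eq_seq_compact_metric
  proof (rule seq_compactI)
    fix w :: "nat \<Rightarrow> 'v"
    assume "\<forall>n. w n \<in> {u. B0 u = 0} \<inter> sphere 0 1"
    then have w: "B0 (w n) = 0" "norm (w n) = 1" for n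
      by auto
    have "Bseq w"
      by (rule BseqI'[of _ 1]) (simp add: w)
    moreover have "(\<lambda>n. B0 (w n)) \<longlonglongrightarrow> 0"
      by (simp add: w)
    ultimately obtain s :: "nat \<Rightarrow> nat" and w0
      where s: "strict_mono s" and w0: "(\<lambda>n. w (s n)) \<longlonglongrightarrow> w0" "B0 w0 = 0"
      by (rule limit.convergent_subsequence)
    have "norm w0 = 1"
      using tendsto_norm[OF w0(1)] by (simp add: w LIMSEQ_const_iff)
    then show "\<exists>l\<in>{u. B0 u = 0} \<inter> sphere 0 1. \<exists>r. strict_mono r \<and> (w \<circ> r) \<longlonglongrightarrow> l"
      using s w0 by (intro bexI[of _ w0] exI[of _ s]) (simp_all add: comp_def)
  qed
  moreover have "\<exists>(s :: nat \<Rightarrow> nat) w0. strict_mono s \<and> (\<lambda>n. w (s n)) \<longlonglongrightarrow> w0 \<and> w0 \<in> {u. B0 u = 0}"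
    if r: "strict_mono r" and w: "\<And>n. w n \<in> {u. B (r n) u = 0}" and "Bseq w" for r :: "nat \<Rightarrow> nat" and w
  proof -
    interpret sub: coercive_mod_compact "\<lambda>n. B (r n)" B0 K \<mu>
      by (rule subsequence[OF r])
    have "(\<lambda>n. B (r n) (w n)) \<longlonglongrightarrow> 0"
      using w by simp
    with \<open>Bseq w\<close> obtain s :: "nat \<Rightarrow> nat" and w0
      where "strict_mono s" "(\<lambda>n. w (s n)) \<longlonglongrightarrow> w0" "B0 w0 = 0"
      by (rule sub.convergent_subsequence)
    then show ?thesis
      by blast
  qed
  ultimately have main: "u0 = 0"
    if "strict_mono r" "\<And>n w. w \<in> {u. B (r n) u = 0} \<Longrightarrow> inner (u n) w = 0" "u \<longlonglongrightarrow> u0"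
      "u0 \<in> {u. B0 u = 0}" for r :: "nat \<Rightarrow> nat" and u u0
    using that by (rule no_escape_if_dimensions_converge[OF sub sub0 _ dim])
  show ?thesis
    unfolding no_kernel_escape_def
  proof (intro allI impI)
    fix r :: "nat \<Rightarrow> nat" and v u
    assume "strict_mono r" and *: "\<forall>n w. B (r n) w = 0 \<longrightarrow> inner (v n) w = 0" "v \<longlonglongrightarrow> u" "B0 u = 0"
    from this(1) show "u = 0"
      by (rule main[of _ v]) (use * in auto)
  qed
qed

theorem theorem5p11:
  fixes j :: "'v :: chilbert_space \<Rightarrow> 'h :: chilbert_space"
    and jt :: "'v \<Rightarrow> 'k :: chilbert_space"
    and a :: "'v form"
    and a_seq :: "nat \<Rightarrow> 'v form"
  assumes "bounded_clinear j"
    and "clinear jt" and "compact_map jt"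
    and "sesquilinear a" and "continuous_form a" and "symmetric_form a"
    and "\<And>n. sesquilinear (a_seq n)" and "\<And>n. continuous_form (a_seq n)"
    and "\<And>n. symmetric_form (a_seq n)"
    and "uniformly_elliptic a_seq jt"
    and "forms_converge_weakly a_seq a"
    and "(\<lambda>n. cdim (form_W j (a_seq n))) \<longlonglongrightarrow> cdim (form_W j a)"
  defines "A \<equiv> form_graph a j"
    and "A_seq \<equiv> \<lambda>n. form_graph (a_seq n) j"
  shows "\<forall>s :: real. s \<noteq> (0 :: real) \<longrightarrow>
      (\<forall>n. graph_invertible (graph_shift (A_seq n) (\<i> * s))) \<and>
      graph_invertible (graph_shift A (\<i> * s)) \<and>
      converges_strongly (\<lambda>n. graph_inverse (graph_shift (A_seq n) (\<i> * s)))
        (graph_inverse (graph_shift A (\<i> * s))) \<and>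
      (compact_map j \<longrightarrow>
        converges_uniformly (\<lambda>n. graph_inverse (graph_shift (A_seq n) (\<i> * s)))
          (graph_inverse (graph_shift A (\<i> * s))))"
proof (rule allI, rule impI)
  fix s :: real
  assume s: "s \<noteq> 0"
  have cj: "clinear j" and bj: "bounded_linear j"
    using assms(1) by (simp_all add: bounded_clinear_def)
  have bjt: "bounded_linear jt"
    using assms(2,3) by (rule compact_map_imp_bounded_linear)
  obtain \<mu> \<omega> where \<mu>: "\<mu> > 0" and "\<omega> > 0"
    and ell: "\<And>n u. Re (a_seq n u u) + \<omega> * (norm (jt u))\<^sup>2 \<ge> \<mu> * (norm u)\<^sup>2"
    using assms(10) unfolding uniformly_elliptic_def by blast
  obtain js where bjs: "bounded_linear js" and js: "\<And>y v. inner (js y) v = inner y (j v)"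
    by (rule adjoint_exists[OF bj]) blast
  obtain jts where bjts: "bounded_linear jts" and jts: "\<And>y v. inner (jts y) v = inner y (jt v)"
    by (rule adjoint_exists[OF bjt]) blast
  define K where "K u = jts (\<omega> *\<^sub>R jt u)" for u
  have bjtsw: "bounded_linear (\<lambda>h. jts (\<omega> *\<^sub>R h))"
    by (rule bounded_linear_compose[OF bjts bounded_linear_scaleR_right])
  have bK: "bounded_linear K"
    unfolding K_def by (rule bounded_linear_compose[OF bjtsw bjt])
  obtain B0 where bB0: "bounded_linear B0"
    and B0: "\<And>u v. inner (B0 u) v = Re (a u v + \<i> * s * cinner (j u) (j v))"
    by (rule resolvent_operator_exists[OF assms(1,4,5), of "\<i> * s"]) blast
  have "\<exists>T. bounded_linear T \<and> (\<forall>u v. inner (T u) v = Re (a_seq n u v + \<i> * s * cinner (j u) (j v)))" for n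
    by (rule resolvent_operator_exists[OF assms(1,7,8), of n "\<i> * s"]) blast
  then obtain B where bB: "\<And>n. bounded_linear (B n)"
    and B: "\<And>n u v. inner (B n u) v = Re (a_seq n u v + \<i> * s * cinner (j u) (j v))"
    by metis
  have strong: "(\<lambda>n. B n v) \<longlonglongrightarrow> B0 v" for v
  proof -
    have "(\<lambda>n. B n v - B0 v) \<longlonglongrightarrow> 0"
      by (rule forms_converge_strongly[OF assms(4-6,9,11), of _ v]) (simp add: inner_diff_left B B0)
    then show ?thesis
      by (simp add: LIM_zero_iff)
  qed
  have K_compact: "relatively_compact_seq (\<lambda>n. K (x n))" if "Bseq x" for x
    unfolding K_def
    by (rule relatively_compact_seq_bounded_linear[OF bjtsw
          compact_map_imp_relatively_compact_seq[OF assms(3) that]])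
  have coercive: "\<mu> * (norm u)\<^sup>2 \<le> inner (B n u + K u) u" for n u
    using ell[of u n] by (simp add: inner_add_left B K_def jts cinner_self power2_norm_eq_inner)
  interpret coercive_mod_compact B B0 K \<mu>
    by (rule coercive_mod_compact.intro[OF bB bB0 bK K_compact strong \<mu> coercive])
  interpret limit: coercive_mod_compact "\<lambda>n. B0" B0 K \<mu>
    by (rule constant_limit_sequence)
  interpret fr: form_resolvent j a s B0 js
    by (rule form_resolvent.intro[OF cj assms(4,6) s B0 js])
  have fr_seq: "form_resolvent j (a_seq n) s (B n) js" for n
    by (rule form_resolvent.intro[OF cj assms(7,9) s B js])
  have ker: "{u. B n u = 0} = form_W j (a_seq n)" for n
    using form_resolvent.T_eq_0_iff[OF fr_seq] by blast
  have ker0: "{u. B0 u = 0} = form_W j a"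
    using fr.T_eq_0_iff by blast
  have gap: no_kernel_escape
    by (rule no_kernel_escape_if_dimensions_converge[OF coercive_mod_compact_axioms];
        unfold ker ker0; intro csubspace_form_W cj assms)
  \<comment> \<open>Right-hand sides \<open>js y\<close> are orthogonal to the kernel of \<open>j\<close>, in particular to the obstruction to solvability.\<close>
  have js_W: "inner (js y) g = 0" if "g \<in> form_W j b" for y g and b :: "'v form"
    using that by (simp add: js form_W_def)
  have "\<exists>u. B n u = js y \<and> (\<forall>w. B n w = 0 \<longrightarrow> inner u w = 0)" for n y
    by (rule solvable[of n "js y"])
      (use js_W form_resolvent.orthogonal_to_range_T[OF fr_seq] in blast)+
  then obtain U where U: "\<And>n y. B n (U n y) = js y" "\<And>n y w. B n w = 0 \<Longrightarrow> inner (U n y) w = 0"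
    by metis
  have "\<exists>u. B0 u = js y \<and> (\<forall>w. B0 w = 0 \<longrightarrow> inner u w = 0)" for y
    by (rule limit.solvable[of "js y"])
      (use js_W fr.orthogonal_to_range_T in blast)+
  then obtain U0 where U0: "\<And>y. B0 (U0 y) = js y" "\<And>y w. B0 w = 0 \<Longrightarrow> inner (U0 y) w = 0"
    by metis
  define R where "R n = graph_inverse (graph_shift (A_seq n) (\<i> * s))" for n
  define R0 where "R0 = graph_inverse (graph_shift A (\<i> * s))"
  have R: "R n y = j (U n y)" for n y
    unfolding R_def A_seq_def by (rule form_resolvent.graph_inverse_eq[OF fr_seq U(1)])
  have R0: "R0 y = j (U0 y)" for y
    unfolding R0_def A_def by (rule fr.graph_inverse_eq[OF U0(1)])
  have inv: "graph_invertible (graph_shift (A_seq n) (\<i> * s))" for n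
    unfolding A_seq_def by (rule form_resolvent.graph_invertible_if_solvable[OF fr_seq]) (use U in blast)
  have inv0: "graph_invertible (graph_shift A (\<i> * s))"
    unfolding A_def by (rule fr.graph_invertible_if_solvable) (use U0 in blast)
  have bR: "bounded_clinear (R n)" for n
    using inv[of n] by (simp add: graph_invertible_def R_def)
  have bR0: "bounded_clinear R0"
    using inv0 by (simp add: graph_invertible_def R0_def)
  \<comment> \<open>Both convergence statements come from this: constant \<open>y\<close> for the first, almost norming vectors for the second.\<close>
  have diff: "(\<lambda>n. R n (y n) - R0 (y n)) \<longlonglongrightarrow> 0" if "relatively_compact_seq (\<lambda>n. js (y n))" for y
    unfolding R R0
  proof (rule difference_of_solutions_tendsto_0[OF bj _ gap that])
    show "j w = 0" if "B0 w = 0" for w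
      using that by (simp add: fr.T_eq_0_iff form_W_def)
  qed (use U U0 in blast)+
  have "(\<lambda>n. R n y) \<longlonglongrightarrow> R0 y" for y
    using diff[of "\<lambda>_. y", OF relatively_compact_seq_const] by (simp add: LIM_zero_iff)
  then have strongly: "converges_strongly R R0"
    by (simp add: converges_strongly_def bR bR0)
  have uniformly: "converges_uniformly R R0" if cpt: "compact_map j"
  proof -
    have bl: "bounded_linear (\<lambda>x. R n x - R0 x)" for n
      using bR[of n] bR0 by (intro bounded_linear_sub) (simp_all add: bounded_clinear_def)
    have "\<exists>y. norm y \<le> 1 \<and> onorm (\<lambda>x. R n x - R0 x) \<le> 2 * norm (R n y - R0 y)" for n
      by (rule onorm_almost_attained[OF bl])
    then obtain y where y: "\<And>n. norm (y n) \<le> 1"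
      and on: "\<And>n. onorm (\<lambda>x. R n x - R0 x) \<le> 2 * norm (R n (y n) - R0 (y n))"
      by metis
    have "Bseq y"
      using y by (rule BseqI')
    then have "relatively_compact_seq (\<lambda>n. js (y n))"
      by (rule adjoint_of_compact_map[OF bounded_linear.linear[OF bj] cpt bjs js])
    then have "(\<lambda>n. R n (y n) - R0 (y n)) \<longlonglongrightarrow> 0"
      by (rule diff)
    then have lim: "(\<lambda>n. 2 * norm (R n (y n) - R0 (y n))) \<longlonglongrightarrow> 0"
      by (intro tendsto_mult_right_zero tendsto_norm_zero)
    have "norm (onorm (\<lambda>x. R n x - R0 x)) \<le> 2 * norm (R n (y n) - R0 (y n))" for n
      using on[of n] onorm_pos_le[OF bl[of n]] by simp
    then have "(\<lambda>n. onorm (\<lambda>x. R n x - R0 x)) \<longlonglongrightarrow> 0"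
      by (rule Lim_null_comparison[OF always_eventually[OF allI] lim])
    then show ?thesis
      by (simp add: converges_uniformly_def bR bR0)
  qed
  show "(\<forall>n. graph_invertible (graph_shift (A_seq n) (\<i> * s))) \<and>
      graph_invertible (graph_shift A (\<i> * s)) \<and>
      converges_strongly (\<lambda>n. graph_inverse (graph_shift (A_seq n) (\<i> * s)))
        (graph_inverse (graph_shift A (\<i> * s))) \<and>
      (compact_map j \<longrightarrow>
        converges_uniformly (\<lambda>n. graph_inverse (graph_shift (A_seq n) (\<i> * s)))
          (graph_inverse (graph_shift A (\<i> * s))))"
    using inv inv0 strongly uniformly unfolding R_def R0_def by blast
qed

end
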